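(* Under the non-degeneracy assumption below, the Mixing method applied to the diagonally constrained SDP $\min_{X\succeq 0}\langle C,X\rangle$ subject to $X_{ii}=1$, $i=1,\ldots,n$, is strictly decreasing in objective value and always converges to a first-order critical point.
   Context: Let $C\in\mathbb{R}^{n\times n}$ be a symmetric cost matrix, and without loss of generality $c_{ii}=0$. The SDP is solved in the low-rank form $\min_{V\in\mathbb{R}^{k\times n}} f(V)=\langle C, V^TV\rangle$ subject to $\|v_i\|=1$ for $i=1,\ldots,n$, where $v_i$ is the $i$-th column of $V$ and $\|\cdot\|$ is the Euclidean norm. The Mixing method initializes each $v_i$ on the unit sphere and cyclically, for $i=1,\ldots,n$, performs the update $v_i := -\sum_{j} c_{ij}v_j \,/\, \|\sum_j c_{ij}v_j\|$ (always using the most recent values of the $v_j$). Non-degeneracy assumption: for all $i$, the norms $\|\sum_{j=1}^n c_{ij}v_j\|$ computed during the procedure are always at least a constant $\delta>0$.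
   Formalization: The objective is shown never to increase over a full cycle and to be strictly decreasing whenever the cycle changes some v_i; at a fixed point (e.g. n=2, c_12=1, v_1=-v_2) the objective value stays constant, so unconditional strict decrease is false. *)

theory Defs
  imports "HOL-Analysis.Analysis"
begin

text \<open>Columns v_0,...,v_{n-1} of V in R^k are modelled as V :: nat => real^'k
  (only indices i < n are meaningful); the cost matrix is C :: nat => nat => real,
  indices 0..n-1.\<close>

definition mix_grad :: "(nat \<Rightarrow> nat \<Rightarrow> real) \<Rightarrow> nat \<Rightarrow> (nat \<Rightarrow> real^'k) \<Rightarrow> nat \<Rightarrow> real^'k" where
  "mix_grad C n V i = (\<Sum>j<n. C i j *\<^sub>R V j)"

definition mix_obj :: "(nat \<Rightarrow> nat \<Rightarrow> real) \<Rightarrow> nat \<Rightarrow> (nat \<Rightarrow> real^'k) \<Rightarrow> real" where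
  "mix_obj C n V = (\<Sum>i<n. \<Sum>j<n. C i j * (V i \<bullet> V j))"

definition mix_update :: "(nat \<Rightarrow> nat \<Rightarrow> real) \<Rightarrow> nat \<Rightarrow> (nat \<Rightarrow> real^'k) \<Rightarrow> nat \<Rightarrow> (nat \<Rightarrow> real^'k)" where
  "mix_update C n V i = V(i := - ((1 / norm (mix_grad C n V i)) *\<^sub>R mix_grad C n V i))"

definition mix_sweep :: "(nat \<Rightarrow> nat \<Rightarrow> real) \<Rightarrow> nat \<Rightarrow> (nat \<Rightarrow> real^'k) \<Rightarrow> (nat \<Rightarrow> real^'k)" where
  "mix_sweep C n V = foldl (mix_update C n) V [0..<n]"

definition mix_iter :: "(nat \<Rightarrow> nat \<Rightarrow> real) \<Rightarrow> nat \<Rightarrow> (nat \<Rightarrow> real^'k) \<Rightarrow> nat \<Rightarrow> (nat \<Rightarrow> real^'k)" where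
  "mix_iter C n V0 r = (mix_sweep C n ^^ r) V0"

definition mix_partial :: "(nat \<Rightarrow> nat \<Rightarrow> real) \<Rightarrow> nat \<Rightarrow> (nat \<Rightarrow> real^'k) \<Rightarrow> nat \<Rightarrow> nat \<Rightarrow> (nat \<Rightarrow> real^'k)" where
  "mix_partial C n V0 r i = foldl (mix_update C n) (mix_iter C n V0 r) [0..<i]"

text \<open>First-order critical point of f on the product of unit spheres:
  the Riemannian gradient (projection of the Euclidean gradient 2 g_i onto the
  tangent space at v_i) vanishes for every i.\<close>
definition mix_critical :: "(nat \<Rightarrow> nat \<Rightarrow> real) \<Rightarrow> nat \<Rightarrow> (nat \<Rightarrow> real^'k) \<Rightarrow> bool" where
  "mix_critical C n V \<longleftrightarrow>
     (\<forall>i<n. norm (V i) = 1 \<and> mix_grad C n V i - (V i \<bullet> mix_grad C n V i) *\<^sub>R V i = 0)"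

end

theory Submission
  imports Defs
begin

text \<open>A block update changes the objective by \<open>- \<parallel>g\<^sub>i\<parallel> \<parallel>v\<^sub>i' - v\<^sub>i\<parallel>\<^sup>2\<close>, so non-degeneracy gives a
  decrease of at least \<open>\<delta>\<close> times the squared movement, while the Riemannian gradient is bounded by a multiple
  of the movement. This alone only makes the movements square summable. To make them summable one needs a
  Kurdyka--Lojasiewicz inequality: a bounded function \<open>\<psi>\<close> of one variable with
  \<open>t - s \<le> \<parallel>grad f(V)\<parallel> (\<psi> t - \<psi> s)\<close> for \<open>f(V) = c + t\<close> and \<open>0 < s \<le> t\<close> small, where \<open>c\<close> is the limit of the
  objective values. It is obtained from a curve that minimises the slope on each level set. The
  curve is semialgebraic by quantifier elimination, hence has eventually continuous and monotone
  coordinates, and \<open>\<psi>\<close> is essentially its arc length in the \<open>l\<^sup>1\<close> norm.\<close>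

section \<open>Sign patterns of univariate polynomials\<close>

text \<open>For \<open>CARD('k)\<close> at least 2 a common rotation of all columns preserves
  \<open>mix_obj\<close>, so critical points come in continua, and square summable movements alone
  do not keep the iterates from drifting along such a set. The inequality for \<psi> excludes this:
  \<open>\<delta> * (move r)\<^sup>2\<close> is at most \<open>n\<close> times the drop of the
  objective, the drop is at most the slope times the drop of \<psi>, and the slope is at most a
  constant times \<open>move r\<close>. Cancelling one factor \<open>move r\<close> bounds the
  movement by a telescoping bounded quantity. The inequality uses differences of \<psi> instead of a
  derivative, so continuity and monotonicity of definable functions near 0 suffice. The squared
  slope, unlike the slope, is a polynomial; hence it is the quantity minimised, and
  \<open>sqrt\<close> occurs only in estimates. Quantifier elimination works with truth values
  rather than formulas: two parameters are compared through one increasing bijection of the line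
  that carries the signs of a whole finite family of polynomials.\<close>

lemma sgn_poly_at_top:
  fixes p :: "real poly"
  assumes "p \<noteq> 0"
  shows "\<exists>N. \<forall>x\<ge>N. sgn (poly p x) = sgn (lead_coeff p)"
proof (cases "lead_coeff p > 0")
  case True
  then show ?thesis
    using poly_pinfty_gt_lc[of p] by (metis less_le_trans sgn_pos)
next
  case False
  then have neg: "lead_coeff p < 0"
    using assms by (meson leading_coeff_0_iff linorder_neqE_linordered_idom)
  then obtain N where N: "\<forall>x\<ge>N. poly (- p) x \<ge> lead_coeff (- p)"
    using poly_pinfty_gt_lc[of "- p"] by auto
  have "poly p x < 0" if "x \<ge> N" for x
    using N[rule_format, OF that] neg by simp
  then show ?thesis
    using neg by (intro exI[of _ N]) simp
qed

lemma sgn_poly_at_bot: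
  fixes p :: "real poly"
  assumes "p \<noteq> 0"
  shows "\<exists>N. \<forall>x\<le>N. sgn (poly p x) = sgn (lead_coeff p) * (- 1) ^ degree p"
proof -
  have deg: "degree [:0, - 1::real:] = 1"
    by simp
  have ne: "p \<circ>\<^sub>p [:0, - 1:] \<noteq> 0"
    using assms by (auto simp: pcompose_eq_0_iff)
  have lc: "lead_coeff (p \<circ>\<^sub>p [:0, - 1:]) = lead_coeff p * (- 1) ^ degree p"
    by (subst lead_coeff_comp) auto
  obtain N where N: "\<forall>x\<ge>N. sgn (poly (p \<circ>\<^sub>p [:0, - 1:]) x) = sgn (lead_coeff p * (- 1) ^ degree p)"
    using sgn_poly_at_top[OF ne] unfolding lc by blast
  have "sgn (poly p x) = sgn (lead_coeff p) * (- 1) ^ degree p" if "x \<le> - N" for x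
    using N[rule_format, of "- x"] that
    by (simp add: poly_pcompose sgn_mult)
  then show ?thesis by blast
qed

lemma sgn_poly_eq_if_no_zero:
  fixes p :: "real poly"
  assumes "\<And>z. u \<le> z \<Longrightarrow> z \<le> v \<Longrightarrow> poly p z \<noteq> 0" and "u \<le> v"
  shows "sgn (poly p u) = sgn (poly p v)"
proof (cases "u = v")
  case False
  then have "u < v" using assms(2) by simp
  have "\<not> (poly p u < 0 \<and> 0 < poly p v)"
    using poly_IVT_pos[OF \<open>u < v\<close>, of p] assms(1) by (metis less_imp_le)
  moreover have "\<not> (poly p v < 0 \<and> 0 < poly p u)"
    using poly_IVT_neg[OF \<open>u < v\<close>, of p] assms(1) by (metis less_imp_le)
  moreover have "poly p u \<noteq> 0" "poly p v \<noteq> 0"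
    using assms by auto
  ultimately show ?thesis by (auto simp: sgn_if)
qed simp

text \<open>The derivative keeps one sign, so the mean value theorem on either side of the root
  gives values of opposite sign at the ends.\<close>

lemma poly_cross_zero:
  fixes p :: "real poly"
  assumes "a < z" "z < b" "poly p z = 0"
    and nz: "\<And>x. a < x \<Longrightarrow> x < b \<Longrightarrow> poly (pderiv p) x \<noteq> 0"
  shows "poly p a * poly p b < 0"
proof -
  obtain x where x: "a < x" "x < z" "poly p z - poly p a = (z - a) * poly (pderiv p) x"
    using poly_MVT[OF assms(1)] by blast
  obtain y where y: "z < y" "y < b" "poly p b - poly p z = (b - z) * poly (pderiv p) y"
    using poly_MVT[OF assms(2)] by blast
  have "sgn (poly (pderiv p) x) = sgn (poly (pderiv p) y)"
    by (rule sgn_poly_eq_if_no_zero) (use x y nz in auto)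
  then have "poly (pderiv p) x * poly (pderiv p) y > 0"
    using nz[of x] nz[of y] x y assms(1,2)
    by (smt (verit, best) mult_neg_neg mult_pos_pos sgn_1_neg sgn_1_pos sgn_if)
  moreover have "poly p a * poly p b = - ((z - a) * (b - z) * (poly (pderiv p) x * poly (pderiv p) y))"
  proof -
    have "poly p a = - ((z - a) * poly (pderiv p) x)" "poly p b = (b - z) * poly (pderiv p) y"
      using x(3) y(3) assms(3) by simp_all
    then show ?thesis by (simp only: mult_minus_left) (simp only: ac_simps)
  qed
  ultimately show ?thesis
    using assms by (simp add: mult_pos_pos)
qed

text \<open>Carries a root from a cell of one polynomial into the corresponding cell of another: the
  signs at the ends are opposite for \<open>p\<close>, hence for \<open>q\<close>, and the
  intermediate value theorem applies.\<close>

lemma poly_zero_transfer: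
  fixes p q :: "real poly"
  assumes "a < z" "z < b" "poly p z = 0"
    and nz: "\<And>x. a < x \<Longrightarrow> x < b \<Longrightarrow> poly (pderiv p) x \<noteq> 0"
    and "sgn (poly p a) = sgn (poly q a')" "sgn (poly p b) = sgn (poly q b')" "a' < b'"
  shows "\<exists>y. a' < y \<and> y < b' \<and> poly q y = 0"
proof -
  have "sgn (poly p a * poly p b) = - 1"
    using poly_cross_zero[OF assms(1-4)] by simp
  then have "sgn (poly q a' * poly q b') = - 1"
    using assms(5,6) by (simp add: sgn_mult)
  then have "poly q a' * poly q b' < 0"
    by (simp only: sgn_1_neg)
  then show ?thesis
    using poly_IVT[OF assms(7)] by blast
qed

text \<open>Rolle's theorem; \<open>min\<close> and \<open>max\<close> spare the uses an ordering of
  the two roots.\<close>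

lemma poly_zero_unique:
  fixes p :: "real poly"
  assumes "poly p x = 0" "poly p y = 0"
    and "\<And>z. min x y < z \<Longrightarrow> z < max x y \<Longrightarrow> poly (pderiv p) z \<noteq> 0"
  shows "x = y"
proof (rule ccontr)
  assume "x \<noteq> y"
  then have "min x y < max x y" by auto
  from poly_MVT[OF this, of p] obtain z where z: "min x y < z" "z < max x y"
    "poly p (max x y) - poly p (min x y) = (max x y - min x y) * poly (pderiv p) z"
    by blast
  moreover have "poly p (max x y) - poly p (min x y) = 0"
    using assms by (simp add: max_def min_def)
  ultimately show False
    using assms(3)[of z] \<open>x \<noteq> y\<close> by (auto simp: max_def min_def split: if_splits)
qed

lemma finite_neighbours:
  fixes Y :: "'a::linorder set"
  assumes "finite Y" "x \<notin> Y" "l \<in> Y" "l < x" "u \<in> Y" "x < u"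
  shows "\<exists>a\<in>Y. \<exists>b\<in>Y. a < x \<and> x < b \<and> (\<forall>y\<in>Y. \<not> (a < y \<and> y < b))"
proof -
  define a where "a = Max {y \<in> Y. y < x}"
  define b where "b = Min {y \<in> Y. x < y}"
  have A: "finite {y \<in> Y. y < x}" "{y \<in> Y. y < x} \<noteq> {}" and B: "finite {y \<in> Y. x < y}" "{y \<in> Y. x < y} \<noteq> {}"
    using assms by auto
  have "a \<in> {y \<in> Y. y < x}" "b \<in> {y \<in> Y. x < y}"
    unfolding a_def b_def using Max_in[OF A] Min_in[OF B] by auto
  moreover have "\<not> (a < y \<and> y < b)" if "y \<in> Y" for y
    using that assms(2) Max_ge[OF A(1), of y] Min_le[OF B(1), of y] unfolding a_def[symmetric] b_def[symmetric]
    by (metis (mono_tags, lifting) leD linorder_neqE mem_Collect_eq)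
  ultimately show ?thesis by blast
qed

text \<open>A piecewise linear map through the prescribed points, extended by rays. Surjectivity
  matters because roots of the target polynomials are pulled back along it.\<close>

lemma strict_mono_interpolation:
  fixes \<beta> :: "real \<Rightarrow> real"
  assumes "finite Y" "strict_mono_on Y \<beta>"
  shows "\<exists>\<phi>. strict_mono \<phi> \<and> surj \<phi> \<and> (\<forall>y\<in>Y. \<phi> y = \<beta> y)"
  using assms
proof (induction Y rule: finite_linorder_max_induct)
  case empty
  show ?case by (intro exI[of _ id]) (auto simp: strict_mono_def)
next
  case (insert b Y)
  have "strict_mono_on Y \<beta>"
    using insert.prems by (rule monotone_on_subset) auto
  then obtain \<phi> where \<phi>: "strict_mono \<phi>" "surj \<phi>" "\<forall>y\<in>Y. \<phi> y = \<beta> y"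
    using insert.IH by blast
  show ?case
  proof (cases "Y = {}")
    case True
    show ?thesis
      by (intro exI[of _ "\<lambda>x. x + (\<beta> b - b)"])
        (auto simp: True strict_mono_def surj_def intro: exI[of _ "_ - (\<beta> b - b)"])
  next
    case False
    define a where "a = Max Y"
    have a: "a \<in> Y" "a < b" "\<And>y. y \<in> Y \<Longrightarrow> y \<le> a"
      using False insert.hyps by (auto simp: a_def)
    \<comment> \<open>Slope of the segment joining the last two prescribed points; beyond
      \<open>a\<close> the map becomes a ray of this slope, which keeps it onto.\<close>
    define c where "c = (\<beta> b - \<beta> a) / (b - a)"
    have "\<beta> a < \<beta> b"
      using insert.prems a by (auto simp: strict_mono_on_def)
    then have c: "c > 0"
      using a by (simp add: c_def)
    define \<psi> where "\<psi> x = (if x \<le> a then \<phi> x else \<phi> a + c * (x - a))" for x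
    have "strict_mono \<psi>"
    proof (rule strict_monoI)
      fix x y :: real
      assume "x < y"
      then show "\<psi> x < \<psi> y"
        using \<phi>(1) c unfolding \<psi>_def strict_mono_def
        by (smt (verit, ccfv_SIG) mult_pos_pos mult_strict_left_mono)
    qed
    moreover have "surj \<psi>"
    proof (rule surjI)
      show "\<psi> (if y \<le> \<phi> a then inv \<phi> y else a + (y - \<phi> a) / c) = y" for y
      proof (cases "y \<le> \<phi> a")
        case True
        have "\<phi> (inv \<phi> y) = y" using \<phi>(2) by (simp add: surj_f_inv_f)
        then have "inv \<phi> y \<le> a"
          using True \<phi>(1) by (metis strict_mono_less_eq)
        then show ?thesis using True \<open>\<phi> (inv \<phi> y) = y\<close> by (simp add: \<psi>_def)
      next
        case False
        then have "(y - \<phi> a) / c > 0" using c by simp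
        then have "\<not> (y - \<phi> a) / c \<le> 0" by simp
        then show ?thesis using False c unfolding \<psi>_def by auto
      qed
    qed
    moreover have "\<forall>y\<in>insert b Y. \<psi> y = \<beta> y"
      using a \<phi>(3) by (auto simp: \<psi>_def c_def)
    ultimately show ?thesis by blast
  qed
qed

text \<open>Stands in for equality of sign tables. Monotonicity and surjectivity of \<phi> are
  stated separately, because one \<phi> has to serve a whole family of pairs.\<close>

definition sgn_match :: "(real \<Rightarrow> real) \<Rightarrow> real poly \<Rightarrow> real poly \<Rightarrow> bool" where
  "sgn_match \<phi> q q' \<longleftrightarrow> (\<forall>x. sgn (poly q x) = sgn (poly q' (\<phi> x)))"

lemma sgn_match_zero_iff: "sgn_match \<phi> q q' \<Longrightarrow> poly q x = 0 \<longleftrightarrow> poly q' (\<phi> x) = 0"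
  unfolding sgn_match_def by (metis sgn_0_0)

text \<open>The roots of the nonzero members of \<open>G\<close> cut the line into cells on which
  \<open>p\<close> is strictly monotone, as its derivative is in \<open>G\<close>. So
  \<open>p\<close> has at most one root inside a cell, and whether it has one is decided by its
  signs at the ends of the cell. These agree with the signs of \<open>p'\<close>: at the roots by
  \<open>at_zeros\<close>, near infinity by degree and leading coefficient. The new map keeps the
  values of \<phi> at the roots of \<open>G\<close> and sends the roots of \<open>p\<close> to those
  of \<open>p'\<close>.\<close>

lemma extend_sgn_match:
  fixes p p' :: "real poly" and G :: "(real poly \<times> real poly) set"
  assumes mono: "strict_mono \<phi>" and surj: "surj \<phi>" and fin: "finite G"
    and match: "\<And>q q'. (q, q') \<in> G \<Longrightarrow> sgn_match \<phi> q q'"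
    and deriv: "(pderiv p, pderiv p') \<in> G"
    and deg: "degree p = degree p'" "degree p > 0" and lc: "sgn (lead_coeff p) = sgn (lead_coeff p')"
    and at_zeros: "\<And>q q' z. (q, q') \<in> G \<Longrightarrow> q \<noteq> 0 \<Longrightarrow> poly q z = 0 \<Longrightarrow> sgn (poly p z) = sgn (poly p' (\<phi> z))"
  shows "\<exists>\<psi>. strict_mono \<psi> \<and> surj \<psi> \<and> (\<forall>(q, q') \<in> insert (p, p') G. sgn_match \<psi> q q')"
proof -
  have p0: "p \<noteq> 0" "p' \<noteq> 0" using deg by auto
  have dp0: "pderiv p \<noteq> 0" "pderiv p' \<noteq> 0"
    using deg by (auto simp: pderiv_eq_0_iff)
  define Z where "Z = (\<Union>(q, q') \<in> {g \<in> G. fst g \<noteq> 0}. {z. poly q z = 0})"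
  have finZ: "finite Z"
    unfolding Z_def using fin by (auto intro!: finite_UN_I poly_roots_finite)
  have Z_sgn: "sgn (poly p z) = sgn (poly p' (\<phi> z))" if "z \<in> Z" for z
    using that at_zeros by (fastforce simp: Z_def)
  obtain N1 where N1: "\<forall>x\<ge>N1. sgn (poly p x) = sgn (lead_coeff p)"
    using sgn_poly_at_top[OF p0(1)] by blast
  obtain N1' where N1': "\<forall>x\<ge>N1'. sgn (poly p' x) = sgn (lead_coeff p')"
    using sgn_poly_at_top[OF p0(2)] by blast
  obtain N0 where N0: "\<forall>x\<le>N0. sgn (poly p x) = sgn (lead_coeff p) * (- 1) ^ degree p"
    using sgn_poly_at_bot[OF p0(1)] by blast
  obtain N0' where N0': "\<forall>x\<le>N0'. sgn (poly p' x) = sgn (lead_coeff p') * (- 1) ^ degree p'"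
    using sgn_poly_at_bot[OF p0(2)] by blast
  have "\<exists>B. \<forall>z\<in>Z. \<bar>z\<bar> < B \<and> \<bar>\<phi> z\<bar> < B"
  proof -
    have "finite ((\<lambda>z. max \<bar>z\<bar> \<bar>\<phi> z\<bar>) ` Z)" using finZ by simp
    then obtain B where "\<forall>w\<in>(\<lambda>z. max \<bar>z\<bar> \<bar>\<phi> z\<bar>) ` Z. w < B"
      by (metis finite_has_maximal bdd_above_finite bdd_above_def gt_ex le_less_trans)
    then show ?thesis by auto
  qed
  then obtain B where B: "\<And>z. z \<in> Z \<Longrightarrow> \<bar>z\<bar> < B \<and> \<bar>\<phi> z\<bar> < B" by blast
  \<comment> \<open>\<open>L\<close> and \<open>U\<close> stand for the two infinities: at and
    beyond them \<open>p\<close> and \<open>p'\<close> have their asymptotic signs, and both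
    \<open>Z\<close> and its image under \<phi> lie strictly between.\<close>
  define L where "L = - (1 + \<bar>B\<bar> + \<bar>N0\<bar> + \<bar>N0'\<bar>)"
  define U where "U = 1 + \<bar>B\<bar> + \<bar>N1\<bar> + \<bar>N1'\<bar>"
  have LU: "L < U" by (simp add: L_def U_def)
  have LZ: "L < z" "z < U" "L < \<phi> z" "\<phi> z < U" if "z \<in> Z" for z
    using B[OF that] by (auto simp: L_def U_def)
  have below: "sgn (poly p x) = sgn (poly p' y)" "poly p x \<noteq> 0" "poly p' y \<noteq> 0" if "x \<le> L" "y \<le> L" for x y
  proof -
    have "sgn (poly p x) = sgn (lead_coeff p) * (- 1) ^ degree p" "sgn (poly p' y) = sgn (lead_coeff p) * (- 1) ^ degree p"
      using N0 N0' that deg lc by (auto simp: L_def)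
    moreover have "sgn (lead_coeff p) * (- 1) ^ degree p \<noteq> 0" using p0 by (simp add: sgn_0_0)
    ultimately show "sgn (poly p x) = sgn (poly p' y)" "poly p x \<noteq> 0" "poly p' y \<noteq> 0"
      by auto
  qed
  have above: "sgn (poly p x) = sgn (poly p' y)" "poly p x \<noteq> 0" "poly p' y \<noteq> 0" if "x \<ge> U" "y \<ge> U" for x y
  proof -
    have "sgn (poly p x) = sgn (lead_coeff p)" "sgn (poly p' y) = sgn (lead_coeff p)"
      using N1 N1' that deg lc by (auto simp: U_def)
    moreover have "sgn (lead_coeff p) \<noteq> 0" using p0 by (simp add: sgn_0_0)
    ultimately show "sgn (poly p x) = sgn (poly p' y)" "poly p x \<noteq> 0" "poly p' y \<noteq> 0"
      by auto
  qed
  define Y where "Y = insert L (insert U Z)"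
  \<comment> \<open>Unlike \<phi>, this map leaves the artificial end points fixed; it is increasing
    on \<open>Y\<close> because they enclose both \<open>Z\<close> and its image.\<close>
  define \<beta> where "\<beta> z = (if z \<in> Z then \<phi> z else z)" for z
  have finY: "finite Y" using finZ by (simp add: Y_def)
  have LUnot: "L \<notin> Z" "U \<notin> Z" using LZ by force+
  have \<beta>mono: "\<beta> x < \<beta> y \<longleftrightarrow> x < y" if "x \<in> Y" "y \<in> Y" for x y
    using that LZ LU LUnot strict_mono_less[OF mono] unfolding \<beta>_def Y_def
    by (smt (verit, best) insert_iff)
  have \<beta>sgn: "sgn (poly p y) = sgn (poly p' (\<beta> y))" if "y \<in> Y" for y
    using that Z_sgn LUnot below(1)[of L L] above(1)[of U U] by (auto simp: \<beta>_def Y_def)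
  have Yfull: "poly (pderiv p) x \<noteq> 0" if "x \<notin> Y" for x
    using that deriv dp0 by (force simp: Y_def Z_def)
  have Yfull': "poly (pderiv p') x \<noteq> 0" if "x \<notin> \<beta> ` Y" for x
  proof
    assume *: "poly (pderiv p') x = 0"
    obtain w where w: "x = \<phi> w" using surj by blast
    then have "poly (pderiv p) w = 0"
      using * sgn_match_zero_iff[OF match[OF deriv]] by simp
    then have "w \<in> Z" using deriv dp0 by (force simp: Z_def)
    then show False using that w by (auto simp: \<beta>_def Y_def image_iff)
  qed
  have zero_in: "L < x \<and> x < U" if "poly p x = 0" for x
    using below(2)[of x L] above(2)[of x U] that by (meson order_refl leI)
  have zero_in': "L < x \<and> x < U" if "poly p' x = 0" for x
    using below(3)[of L x] above(3)[of U x] that by (meson order_refl leI)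
  have nb: "\<exists>a\<in>Y. \<exists>b\<in>Y. a < x \<and> x < b \<and> (\<forall>y\<in>Y. \<not> (a < y \<and> y < b))" if x: "x \<notin> Y" "L < x" "x < U" for x
    using finite_neighbours[OF finY x(1), of L U] x by (auto simp: Y_def)
  \<comment> \<open>\<open>R x y\<close>: the root \<open>y\<close> of \<open>p'\<close> has the
    same position among the \<beta>-images of \<open>Y\<close> as \<open>x\<close> has in
    \<open>Y\<close>. For a root \<open>x\<close> of \<open>p\<close> there is exactly one such
    \<open>y\<close>.\<close>
  define R where "R x y \<longleftrightarrow> poly p' y = 0 \<and> (\<forall>z\<in>Y. (x < z \<longleftrightarrow> y < \<beta> z) \<and> (z < x \<longleftrightarrow> \<beta> z < y))" for x y
  have cell_iff: "R x y" if h: "a \<in> Y" "b \<in> Y" "a < x" "x < b" "\<forall>y\<in>Y. \<not> (a < y \<and> y < b)"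
      "\<beta> a < y" "y < \<beta> b" "poly p' y = 0" for a b x y
    unfolding R_def
  proof (intro conjI ballI)
    fix z assume z: "z \<in> Y"
    then consider "z \<le> a" | "b \<le> z" using h(5) by force
    then have "z < x \<and> \<beta> z < y \<or> x < z \<and> y < \<beta> z"
    proof cases
      case 1
      then have "\<beta> z \<le> \<beta> a" using \<beta>mono[OF h(1) z] by auto
      then show ?thesis using 1 h by auto
    next
      case 2
      then have "\<beta> b \<le> \<beta> z" using \<beta>mono[OF z h(2)] by auto
      then show ?thesis using 2 h by auto
    qed
    then show "(x < z) = (y < \<beta> z)" "(z < x) = (\<beta> z < y)" by auto
  qed (fact h)
  have nb_image: "y \<notin> \<beta> ` Y" if "a \<in> Y" "b \<in> Y" "\<beta> a < y" "y < \<beta> b" "\<forall>y\<in>Y. \<not> (a < y \<and> y < b)" for a b y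
    using that \<beta>mono by blast
  have ex: "\<exists>y. R x y" if x: "poly p x = 0" for x
  proof (cases "x \<in> Y")
    case True
    then have "R x (\<beta> x)"
      unfolding R_def using \<beta>sgn[OF True] x \<beta>mono by (auto simp: sgn_0_0 sgn_zero_iff)
    then show ?thesis by blast
  next
    case False
    then obtain a b where ab: "a \<in> Y" "b \<in> Y" "a < x" "x < b" "\<forall>y\<in>Y. \<not> (a < y \<and> y < b)"
      using nb zero_in[OF x] by blast
    have "\<exists>y. \<beta> a < y \<and> y < \<beta> b \<and> poly p' y = 0"
    proof (rule poly_zero_transfer[OF ab(3,4) x])
      show "poly (pderiv p) w \<noteq> 0" if "a < w" "w < b" for w
        using that ab(5) Yfull by blast
    qed (use ab \<beta>sgn \<beta>mono in auto)
    then show ?thesis using cell_iff[OF ab] by blast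
  qed
  have uniq: "y = y'" if h: "R x y" "R x y'" "poly p x = 0" for x y y'
  proof (cases "x \<in> Y")
    case True
    then show ?thesis using h unfolding R_def by (metis linorder_neq_iff)
  next
    case False
    then obtain a b where ab: "a \<in> Y" "b \<in> Y" "a < x" "x < b" "\<forall>y\<in>Y. \<not> (a < y \<and> y < b)"
      using nb zero_in h(3) by blast
    have *: "\<beta> a < y" "y < \<beta> b" "\<beta> a < y'" "y' < \<beta> b"
      using ab h unfolding R_def by auto
    show ?thesis
    proof (rule poly_zero_unique[of p'])
      fix z assume "min y y' < z" "z < max y y'"
      then have "\<beta> a < z" "z < \<beta> b" using * by auto
      then show "poly (pderiv p') z \<noteq> 0"
        using Yfull' nb_image ab by blast
    qed (use h in \<open>auto simp: R_def\<close>)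
  qed
  define \<gamma> where "\<gamma> x = (if x \<in> Y then \<beta> x else (SOME y. R x y))" for x
  have \<gamma>R: "R x (\<gamma> x)" if "poly p x = 0" for x
  proof (cases "x \<in> Y")
    case True
    then show ?thesis
      unfolding R_def \<gamma>_def using \<beta>sgn[OF True] that \<beta>mono by (auto simp: sgn_zero_iff)
  qed (use ex[OF that] in \<open>auto simp: \<gamma>_def intro: someI_ex\<close>)
  have onto: "\<exists>x. poly p x = 0 \<and> \<gamma> x = y" if y: "poly p' y = 0" for y
  proof (cases "y \<in> \<beta> ` Y")
    case True
    then obtain x where x: "x \<in> Y" "y = \<beta> x" by blast
    then have "poly p x = 0" using \<beta>sgn[OF x(1)] y by (auto simp: sgn_zero_iff)
    then show ?thesis using x by (auto simp: \<gamma>_def)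
  next
    case False
    have "\<beta> L = L" "\<beta> U = U" using LUnot by (auto simp: \<beta>_def)
    then have "L \<in> \<beta> ` Y" "U \<in> \<beta> ` Y" by (force simp: Y_def)+
    then have "\<exists>a'\<in>\<beta> ` Y. \<exists>b'\<in>\<beta> ` Y. a' < y \<and> y < b' \<and> (\<forall>w\<in>\<beta> ` Y. \<not> (a' < w \<and> w < b'))"
      by (intro finite_neighbours[of "\<beta> ` Y" y L U] finite_imageI finY False)
        (use zero_in'[OF y] in simp_all)
    then obtain a' b' where ab': "a' \<in> \<beta> ` Y" "b' \<in> \<beta> ` Y" "a' < y" "y < b'"
       and ab'': "\<forall>w\<in>\<beta> ` Y. \<not> (a' < w \<and> w < b')"
      by (elim bexE conjE)
    then obtain a b where ab: "a \<in> Y" "b \<in> Y" "a' = \<beta> a" "b' = \<beta> b" by auto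
    have lt: "a < b" using ab' ab \<beta>mono by force
    have no: "\<forall>w\<in>Y. \<not> (a < w \<and> w < b)"
      using ab'' ab \<beta>mono by blast
    have "\<exists>x. a < x \<and> x < b \<and> poly p x = 0"
    proof (rule poly_zero_transfer[OF ab'(3,4) y])
      show "poly (pderiv p') w \<noteq> 0" if "a' < w" "w < b'" for w
        using that ab'' Yfull' by blast
    qed (use ab \<beta>sgn lt in auto)
    then obtain x where x: "a < x" "x < b" "poly p x = 0" by blast
    have "R x y"
      by (rule cell_iff[OF ab(1,2) x(1,2) no]) (use ab' ab y in auto)
    then show ?thesis using uniq[OF \<gamma>R[OF x(3)] _ x(3)] x(3) by blast
  qed
  define W where "W = Y \<union> {x. poly p x = 0}"
  have finW: "finite W" using finY poly_roots_finite[OF p0(1)] by (simp add: W_def)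
  have \<gamma>Y: "\<gamma> y = \<beta> y" if "y \<in> Y" for y using that by (simp add: \<gamma>_def)
  have "strict_mono_on W \<gamma>"
  proof (rule strict_mono_onI)
    fix x y assume xy: "x \<in> W" "y \<in> W" "x < y"
    consider "x \<in> Y" "y \<in> Y" | "x \<in> Y" "poly p y = 0" | "poly p x = 0" "y \<in> Y"
      | "poly p x = 0" "poly p y = 0" "x \<notin> Y" "y \<notin> Y"
      using xy by (auto simp: W_def)
    then show "\<gamma> x < \<gamma> y"
    proof cases
      case 1 then show ?thesis using \<beta>mono xy by (simp add: \<gamma>Y)
    next
      case 2 then show ?thesis using \<gamma>R[OF 2(2)] xy by (simp add: \<gamma>Y R_def)
    next
      case 3 then show ?thesis using \<gamma>R[OF 3(1)] xy by (simp add: \<gamma>Y R_def)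
    next
      case 4
      have "\<exists>z\<in>Y. x < z \<and> z < y"
      proof (rule ccontr)
        assume "\<not> ?thesis"
        then have "x = y"
          using Yfull xy by (intro poly_zero_unique[OF 4(1,2)]) auto
        then show False using xy by simp
      qed
      then obtain z where z: "z \<in> Y" "x < z" "z < y" by blast
      then have "\<gamma> x < \<beta> z" "\<beta> z < \<gamma> y"
        using \<gamma>R[OF 4(1)] \<gamma>R[OF 4(2)] by (auto simp: R_def)
      then show ?thesis by simp
    qed
  qed
  then obtain \<psi> where \<psi>: "strict_mono \<psi>" "surj \<psi>" "\<And>w. w \<in> W \<Longrightarrow> \<psi> w = \<gamma> w"
    using strict_mono_interpolation[OF finW] by blast
  have \<psi>zero: "poly p x = 0 \<longleftrightarrow> poly p' (\<psi> x) = 0" for x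
  proof
    assume x: "poly p x = 0"
    then have "\<psi> x = \<gamma> x" using \<psi>(3) by (simp add: W_def)
    then show "poly p' (\<psi> x) = 0" using \<gamma>R[OF x] by (simp add: R_def)
  next
    assume "poly p' (\<psi> x) = 0"
    then obtain w where w: "poly p w = 0" "\<gamma> w = \<psi> x" using onto by blast
    then have "\<psi> w = \<psi> x" using \<psi>(3) by (simp add: W_def)
    then have "w = x" using \<psi>(1) by (simp add: strict_mono_eq)
    then show "poly p x = 0" using w by simp
  qed
  \<comment> \<open>Both polynomials keep their sign along a root-free interval, so agreement at a
    point of \<open>Y\<close> spreads to every \<open>x\<close> reachable from it without meeting a
    root.\<close>
  have transfer: "sgn (poly p x) = sgn (poly p' (\<psi> x))"
    if y: "y \<in> Y" and no: "\<And>z. min x y \<le> z \<Longrightarrow> z \<le> max x y \<Longrightarrow> poly p z \<noteq> 0" for x y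
  proof -
    have "sgn (poly p (min x y)) = sgn (poly p (max x y))"
      by (rule sgn_poly_eq_if_no_zero) (use no in auto)
    then have 1: "sgn (poly p x) = sgn (poly p y)" by (auto simp: min_def max_def split: if_splits)
    have mm: "\<psi> (min x y) = min (\<psi> x) (\<psi> y)" "\<psi> (max x y) = max (\<psi> x) (\<psi> y)"
      using strict_mono_less_eq[OF \<psi>(1)] by (auto simp: min_def max_def)
    have "sgn (poly p' (min (\<psi> x) (\<psi> y))) = sgn (poly p' (max (\<psi> x) (\<psi> y)))"
    proof (rule sgn_poly_eq_if_no_zero)
      fix z assume z: "min (\<psi> x) (\<psi> y) \<le> z" "z \<le> max (\<psi> x) (\<psi> y)"
      obtain w where w: "z = \<psi> w" using \<psi>(2) by blast
      then have "min x y \<le> w" "w \<le> max x y"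
        using z mm strict_mono_less_eq[OF \<psi>(1)] by metis+
      then show "poly p' z \<noteq> 0" using no \<psi>zero w by blast
    qed simp
    then have 2: "sgn (poly p' (\<psi> x)) = sgn (poly p' (\<psi> y))" by (auto simp: min_def max_def split: if_splits)
    have "\<psi> y = \<beta> y" using y \<psi>(3) by (simp add: W_def \<gamma>Y)
    then show ?thesis using 1 2 \<beta>sgn[OF y] by simp
  qed
  have "sgn_match \<psi> p p'"
    unfolding sgn_match_def
  proof
    fix x
    show "sgn (poly p x) = sgn (poly p' (\<psi> x))"
    proof (cases "poly p x = 0")
      case True
      then show ?thesis using \<psi>zero[of x] by simp
    next
      case nz: False
      consider "x \<in> Y" | "x < L" | "x > U" | "x \<notin> Y" "L < x" "x < U"
        unfolding Y_def by force
      then show ?thesis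
      proof cases
        case 1 then show ?thesis using transfer[of x x] nz by auto
      next
        case 2
        then show ?thesis
          by (intro transfer[of L]) (use below(2)[of _ L] in \<open>auto simp: Y_def\<close>)
      next
        case 3
        then show ?thesis
          by (intro transfer[of U]) (use above(2)[of _ U] in \<open>auto simp: Y_def\<close>)
      next
        case 4
        then obtain a b where ab: "a \<in> Y" "b \<in> Y" "a < x" "x < b" "\<forall>y\<in>Y. \<not> (a < y \<and> y < b)"
          using nb by blast
        \<comment> \<open>One of the two halves of the cell contains no root: a root on either side
          of \<open>x\<close> would give two distinct roots in one cell.\<close>
        have "(\<forall>z. a \<le> z \<and> z \<le> x \<longrightarrow> poly p z \<noteq> 0) \<or> (\<forall>z. x \<le> z \<and> z \<le> b \<longrightarrow> poly p z \<noteq> 0)"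
        proof (rule ccontr)
          assume "\<not> ?thesis"
          then obtain z w where zw: "a \<le> z" "z \<le> x" "poly p z = 0" "x \<le> w" "w \<le> b" "poly p w = 0" by blast
          have "z = w"
          proof (rule poly_zero_unique[OF zw(3,6)])
            fix v assume "min z w < v" "v < max z w"
            then have "a < v" "v < b" using zw ab by auto
            then show "poly (pderiv p) v \<noteq> 0" using Yfull ab(5) by blast
          qed
          then show False using zw nz by auto
        qed
        then show ?thesis
          using transfer[OF ab(1), of x] transfer[OF ab(2), of x] ab by auto
      qed
    qed
  qed
  \<comment> \<open>Changing \<phi> to \<psi> does no harm to \<open>G\<close>: a root of
    \<open>q'\<close> between \<open>\<phi> x\<close> and \<open>\<psi> x\<close> would be a common
    value of both increasing maps at a point of \<open>Z\<close>, which forces that point to be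
    \<open>x\<close>.\<close>
  moreover have "sgn_match \<psi> q q'" if G: "(q, q') \<in> G" for q q'
  proof (cases "q = 0")
    case True
    have "sgn (poly q' y) = 0" for y
      using match[OF G] surj True unfolding sgn_match_def by (metis poly_0 sgn_0 surjD)
    then show ?thesis using True by (simp add: sgn_match_def)
  next
    case False
    show ?thesis
      unfolding sgn_match_def
    proof
      fix x
      have "sgn (poly q' (min (\<phi> x) (\<psi> x))) = sgn (poly q' (max (\<phi> x) (\<psi> x)))"
      proof (cases "\<phi> x = \<psi> x")
        case ne: False
        show ?thesis
        proof (rule sgn_poly_eq_if_no_zero)
          fix w assume w: "min (\<phi> x) (\<psi> x) \<le> w" "w \<le> max (\<phi> x) (\<psi> x)"
          show "poly q' w \<noteq> 0"
          proof
            assume w0: "poly q' w = 0"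
            obtain z where z: "w = \<phi> z" using surj by blast
            then have "poly q z = 0" using w0 sgn_match_zero_iff[OF match[OF G]] by simp
            then have "z \<in> Z" using G False by (force simp: Z_def)
            then have eq: "\<psi> z = \<phi> z" using \<psi>(3) by (simp add: W_def Y_def \<gamma>_def \<beta>_def)
            then have "x = z"
              using w z strict_mono_less_eq[OF mono] strict_mono_less_eq[OF \<psi>(1)]
              by (metis min_le_iff_disj le_max_iff_disj antisym linear)
            then show False using eq ne by simp
          qed
        qed simp
      qed simp
      then have "sgn (poly q' (\<phi> x)) = sgn (poly q' (\<psi> x))"
        by (auto simp: min_def max_def split: if_splits)
      then show "sgn (poly q x) = sgn (poly q' (\<psi> x))"
        using match[OF G] by (simp add: sgn_match_def)
    qed
  qed
  ultimately show ?thesis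
    using \<psi> by blast
qed

section \<open>Quantifier elimination over the reals\<close>

text \<open>Polynomials are represented by the functions they define on infinite variable
  assignments, so substitution is composition and binding a variable is
  \<open>case_nat\<close>.\<close>

inductive polyfun :: "((nat \<Rightarrow> real) \<Rightarrow> real) \<Rightarrow> bool" where
  const: "polyfun (\<lambda>e. c)"
| var: "polyfun (\<lambda>e. e i)"
| add: "polyfun f \<Longrightarrow> polyfun g \<Longrightarrow> polyfun (\<lambda>e. f e + g e)"
| mult: "polyfun f \<Longrightarrow> polyfun g \<Longrightarrow> polyfun (\<lambda>e. f e * g e)"

lemma polyfun_minus: "polyfun f \<Longrightarrow> polyfun (\<lambda>e. - f e)"
  using polyfun.mult[OF polyfun.const[of "- 1"], of f] by simp

lemma polyfun_diff: "polyfun f \<Longrightarrow> polyfun g \<Longrightarrow> polyfun (\<lambda>e. f e - g e)"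
  using polyfun.add[OF _ polyfun_minus[of g], of f] by simp

lemma polyfun_sum: "(\<And>i. i \<in> I \<Longrightarrow> polyfun (f i)) \<Longrightarrow> polyfun (\<lambda>e. \<Sum>i\<in>I. f i e)"
  by (induction I rule: infinite_finite_induct) (auto intro: polyfun.intros)

lemma polyfun_power: "polyfun f \<Longrightarrow> polyfun (\<lambda>e. f e ^ m)"
  by (induction m) (auto intro: polyfun.intros)

lemma polyfun_if: "polyfun f \<Longrightarrow> polyfun g \<Longrightarrow> polyfun (\<lambda>e. if b then f e else g e)"
  by (cases b) simp_all

lemmas polyfun_intros = polyfun.intros polyfun_minus polyfun_diff polyfun_sum polyfun_power polyfun_if

lemma polyfun_subst:
  assumes "polyfun f" "\<And>k. polyfun (\<lambda>e. s e k)"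
  shows "polyfun (\<lambda>e. f (s e))"
  using assms by (induction) (auto intro: polyfun.intros)

text \<open>Univariate polynomials whose coefficients depend polynomially on parameters. The degree
  may drop for special parameters, so degree bounds are always stated separately.\<close>

definition polyfam :: "((nat \<Rightarrow> real) \<Rightarrow> real poly) \<Rightarrow> bool" where
  "polyfam q \<longleftrightarrow> (\<forall>i. polyfun (\<lambda>e. coeff (q e) i))"

lemma polyfam_add: "polyfam p \<Longrightarrow> polyfam q \<Longrightarrow> polyfam (\<lambda>e. p e + q e)"
  by (simp add: polyfam_def polyfun.add)

lemma polyfam_diff: "polyfam p \<Longrightarrow> polyfam q \<Longrightarrow> polyfam (\<lambda>e. p e - q e)"
  by (simp add: polyfam_def polyfun_diff)

lemma polyfam_smult: "polyfun a \<Longrightarrow> polyfam q \<Longrightarrow> polyfam (\<lambda>e. smult (a e) (q e))"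
  by (simp add: polyfam_def polyfun.mult)

lemma polyfam_mult: "polyfam p \<Longrightarrow> polyfam q \<Longrightarrow> polyfam (\<lambda>e. p e * q e)"
  by (auto simp: polyfam_def coeff_mult intro!: polyfun_intros)

lemma polyfam_const: "polyfam (\<lambda>e. p)"
  by (simp add: polyfam_def polyfun.const)

lemma polyfam_pderiv: "polyfam q \<Longrightarrow> polyfam (\<lambda>e. pderiv (q e))"
  unfolding polyfam_def coeff_pderiv by (auto intro!: polyfun.intros)

lemma polyfam_of_polyfun: "polyfun a \<Longrightarrow> polyfam (\<lambda>e. [:a e:])"
  unfolding polyfam_def
proof
  fix i assume "polyfun a"
  then show "polyfun (\<lambda>e. coeff [:a e:] i)"
    by (cases i) (auto intro: polyfun.intros)
qed

text \<open>Coordinate 0 becomes the indeterminate. The degree bound is uniform in the parameters,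
  which is what lets elimination proceed by induction on the degree.\<close>

lemma polyfun_as_poly:
  assumes "polyfun a"
  shows "\<exists>q d. polyfam q \<and> (\<forall>e. degree (q e) \<le> d) \<and> (\<forall>e x. poly (q e) x = a (case_nat x e))"
  using assms
proof induction
  case (const c)
  show ?case
    by (rule exI[of _ "\<lambda>e. [:c:]"]) (auto intro: polyfam_const)
next
  case (var i)
  show ?case
  proof (cases i)
    case 0
    then show ?thesis
      by (intro exI[of _ "\<lambda>e. [:0, 1:]"]) (auto intro: polyfam_const)
  next
    case (Suc k)
    then show ?thesis
      by (intro exI[of _ "\<lambda>e. [:e k:]"]) (auto intro: polyfam_of_polyfun polyfun.intros)
  qed
next
  case (add f g)
  then obtain q d q' d' where "polyfam q" "polyfam q'" and d: "\<And>e. degree (q e) \<le> d" "\<And>e. degree (q' e) \<le> d'"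
    "\<And>e x. poly (q e) x = f (case_nat x e)" "\<And>e x. poly (q' e) x = g (case_nat x e)" by metis
  moreover have "degree (q e + q' e) \<le> max d d'" for e
    by (rule degree_add_le) (use d in \<open>auto simp: le_max_iff_disj\<close>)
  ultimately show ?case
    by (intro exI[of _ "\<lambda>e. q e + q' e"] exI[of _ "max d d'"])
      (auto intro: polyfam_add)
next
  case (mult f g)
  then obtain q d q' d' where "polyfam q" "polyfam q'" and d: "\<And>e. degree (q e) \<le> d" "\<And>e. degree (q' e) \<le> d'"
    "\<And>e x. poly (q e) x = f (case_nat x e)" "\<And>e x. poly (q' e) x = g (case_nat x e)" by metis
  moreover have "degree (q e * q' e) \<le> d + d'" for e
    using degree_mult_le[of "q e" "q' e"] d(1)[of e] d(2)[of e] by linarith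
  ultimately show ?case
    by (intro exI[of _ "\<lambda>e. q e * q' e"] exI[of _ "d + d'"]) (auto intro: polyfam_mult)
qed

section \<open>Sign conditions on parameters and pseudo-division\<close>

definition same_sgn :: "((nat \<Rightarrow> real) \<Rightarrow> real) set \<Rightarrow> (nat \<Rightarrow> real) \<Rightarrow> (nat \<Rightarrow> real) \<Rightarrow> bool" where
  "same_sgn A e e' \<longleftrightarrow> (\<forall>a\<in>A. sgn (a e) = sgn (a e'))"

text \<open>There are finitely many sign vectors indexed by \<open>A\<close>; one parameter is kept
  for each vector realised in \<open>E\<close>.\<close>

lemma same_sgn_finite_reps:
  assumes "finite A"
  shows "\<exists>R\<subseteq>E. finite R \<and> (\<forall>e\<in>E. \<exists>r\<in>R. same_sgn A e r)"
proof -
  define f where "f e = restrict (\<lambda>a. sgn (a e)) A" for e :: "nat \<Rightarrow> real"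
  have "f ` E \<subseteq> PiE A (\<lambda>_. {- 1, 0, 1})"
  proof (rule image_subsetI)
    fix e
    have "sgn x \<in> {- 1, 0, 1}" for x :: real by (simp add: sgn_if)
    then show "f e \<in> PiE A (\<lambda>_. {- 1, 0, 1})"
      unfolding f_def by (simp add: restrict_PiE_iff)
  qed
  then have "finite (f ` E)"
    using assms by (meson finite_PiE finite.intros finite_subset)
  then obtain R where R: "R \<subseteq> E" "finite R" "f ` E = f ` R"
    using finite_subset_image[of "f ` E" f E] by auto
  have "same_sgn A e r" if "f e = f r" for e r
    using that unfolding f_def same_sgn_def by (metis restrict_apply')
  then show ?thesis
    using R by (metis imageE image_eqI)
qed

text \<open>Pseudo-division: the positive factor \<^term>\<open>a e\<close> is a power of the squared leading
  coefficient of the divisor, which keeps the coefficients of the remainder polynomial in the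
  parameters without spoiling signs.\<close>

lemma pseudo_remainder:
  assumes h: "polyfam h" "\<And>e. e \<in> E \<Longrightarrow> degree (h e) = d" "d > 0"
  shows "polyfam p \<Longrightarrow> (\<And>e. e \<in> E \<Longrightarrow> degree (p e) \<le> D) \<Longrightarrow>
    \<exists>r. polyfam r \<and> (\<forall>e\<in>E. degree (r e) < d \<and>
      (\<exists>a>0. \<forall>x. poly (h e) x = 0 \<longrightarrow> poly (r e) x = a * poly (p e) x))"
proof (induction D arbitrary: p)
  case 0
  then show ?case
    using h(3) by (intro exI[of _ p]) (auto intro!: exI[of _ "1::real"])
next
  case (Suc D)
  show ?case
  proof (cases "Suc D < d")
    case True
    then show ?thesis
      using Suc.prems by (intro exI[of _ p]) (fastforce intro!: exI[of _ "1::real"])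
  next
    case False
    define lc where "lc e = coeff (h e) d" for e
    \<comment> \<open>A multiple of \<open>h e\<close> whose coefficient at \<open>Suc D\<close>
      equals that of the scaled \<open>p e\<close>; subtracting it lowers the degree bound and
      changes nothing at the roots of \<open>h e\<close>.\<close>
    define s where "s e = smult (lc e * coeff (p e) (Suc D)) (monom 1 (Suc D - d) * h e)" for e
    define p1 where "p1 e = smult ((lc e)\<^sup>2) (p e) - s e" for e
    have lc: "polyfun lc" using h(1) by (simp add: polyfam_def lc_def[abs_def])
    have "polyfam p1"
      unfolding p1_def s_def using Suc.prems(1) h(1) lc
      by (intro polyfam_diff polyfam_smult polyfam_mult polyfam_const polyfun_power polyfun.mult)
        (auto simp: polyfam_def)
    moreover have "degree (p1 e) \<le> D" if e: "e \<in> E" for e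
    proof (rule degree_le, intro allI impI)
      fix i assume i: "D < i"
      show "coeff (p1 e) i = 0"
      proof (cases "i = Suc D")
        case True
        then show ?thesis
          using False by (simp add: p1_def s_def coeff_monom_mult lc_def power2_eq_square)
      next
        case ne: False
        then have "coeff (p e) i = 0" "coeff (h e) (i - (Suc D - d)) = 0"
          using i False Suc.prems(2)[OF e] h(2)[OF e] by (auto intro!: coeff_eq_0)
        then show ?thesis
          by (simp add: p1_def s_def coeff_monom_mult)
      qed
    qed
    ultimately obtain r where r: "polyfam r" "\<And>e. e \<in> E \<Longrightarrow> degree (r e) < d"
      "\<And>e. e \<in> E \<Longrightarrow> \<exists>a>0. \<forall>x. poly (h e) x = 0 \<longrightarrow> poly (r e) x = a * poly (p1 e) x"
      using Suc.IH[of p1] by blast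
    have "\<exists>a>0. \<forall>x. poly (h e) x = 0 \<longrightarrow> poly (r e) x = a * poly (p e) x" if e: "e \<in> E" for e
    proof -
      obtain a where a: "a > 0" "\<And>x. poly (h e) x = 0 \<Longrightarrow> poly (r e) x = a * poly (p1 e) x"
        using r(3)[OF e] by blast
      have "lc e \<noteq> 0"
        using h(2)[OF e] h(3) unfolding lc_def by (metis degree_0 leading_coeff_0_iff less_irrefl)
      then have "a * (lc e)\<^sup>2 > 0" using a by simp
      moreover have "poly (p1 e) x = (lc e)\<^sup>2 * poly (p e) x" if "poly (h e) x = 0" for x
        using that by (simp add: p1_def s_def)
      ultimately show ?thesis
        using a by (intro exI[of _ "a * (lc e)\<^sup>2"]) (simp add: mult.assoc)
    qed
    then show ?thesis using r by blast
  qed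
qed

lemma degree_eq_if_same_coeff_zeros:
  assumes "degree p \<le> D" "degree q \<le> D" "\<And>i. i \<le> D \<Longrightarrow> coeff p i = 0 \<longleftrightarrow> coeff q i = 0"
  shows "degree p = degree q"
proof -
  have *: "coeff p i = 0 \<longleftrightarrow> coeff q i = 0" for i
    using assms by (cases "i \<le> D") (auto intro: coeff_eq_0)
  have "degree p \<le> degree q"
    by (rule degree_le) (simp add: * coeff_eq_0)
  moreover have "degree q \<le> degree p"
    by (rule degree_le) (simp add: *[symmetric] coeff_eq_0)
  ultimately show ?thesis by simp
qed

text \<open>The Cohen--Hoermander elimination step, phrased without sign tables: parameters agreeing on
  the signs of finitely many polynomials give families of univariate polynomials that
  differ only by an increasing change of variable. A polynomial of top degree is traded for its
  derivative and its remainders modulo the other members.\<close>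

lemma uniform_sgn_match:
  assumes "finite F" "finite H" "card H \<le> m" "\<And>q. q \<in> F \<union> H \<Longrightarrow> polyfam q"
    "\<And>q e. q \<in> F \<Longrightarrow> e \<in> E \<Longrightarrow> degree (q e) < D" "\<And>q e. q \<in> H \<Longrightarrow> e \<in> E \<Longrightarrow> degree (q e) \<le> D"
  shows "\<exists>B. finite B \<and> (\<forall>b\<in>B. polyfun b) \<and> (\<forall>e\<in>E. \<forall>e'\<in>E. same_sgn B e e' \<longrightarrow>
    (\<exists>\<phi>. strict_mono \<phi> \<and> surj \<phi> \<and> (\<forall>q\<in>F \<union> H. sgn_match \<phi> (q e) (q e'))))"
  using assms
\<comment> \<open>The inner induction is on \<open>m\<close>, which bounds the number of members
  that may still reach the top degree. A member of \<open>H\<close> is removed at the price of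
  finitely many members of lower degree in \<open>F\<close>.\<close>
proof (induction D arbitrary: F H m E)
  case 0
  define B where "B = (\<lambda>q e. coeff (q e) 0) ` (F \<union> H)"
  have "sgn_match id (q e) (q e')" if e: "e \<in> E" "e' \<in> E" "same_sgn B e e'" and q: "q \<in> F \<union> H" for e e' q
  proof -
    have "degree (q e) = 0" "degree (q e') = 0"
      using 0 e q by (metis UnE le_zero_eq not_less_zero)+
    then obtain c c' where "q e = [:c:]" "q e' = [:c':]" by (metis degree_eq_zeroE)
    moreover have "sgn (coeff (q e) 0) = sgn (coeff (q e') 0)"
      using e(3) q by (auto simp: same_sgn_def B_def)
    ultimately show ?thesis by (simp add: sgn_match_def)
  qed
  moreover have "finite B" "\<forall>b\<in>B. polyfun b"
    using 0 by (auto simp: B_def polyfam_def)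
  moreover have "strict_mono (id :: real \<Rightarrow> real)" by (simp add: strict_mono_def)
  ultimately show ?case
    using surj_id by blast
next
  case (Suc D)
  note IHD = Suc.IH
  show ?case
    using Suc.prems
  proof (induction m arbitrary: F H E)
    case 0
    then have "H = {}" by simp
    have "\<exists>B. finite B \<and> (\<forall>b\<in>B. polyfun b) \<and> (\<forall>e\<in>E. \<forall>e'\<in>E. same_sgn B e e' \<longrightarrow>
      (\<exists>\<phi>. strict_mono \<phi> \<and> surj \<phi> \<and> (\<forall>q\<in>{} \<union> F. sgn_match \<phi> (q e) (q e'))))"
    proof (rule IHD)
      show "degree (q e) \<le> D" if "q \<in> F" "e \<in> E" for q e
        using 0(5)[OF that] by simp
    qed (use 0 in auto)
    then show ?case using \<open>H = {}\<close> by simp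
  next
    case (Suc m)
    note IHm = Suc.IH and prems = Suc.prems
    show ?case
    proof (cases "card H \<le> m")
      case True
      then show ?thesis using IHm[of F H E] prems by blast
    next
      case False
      then obtain p where p: "p \<in> H" by force
      define K where "K = H - {p}"
      have K: "finite K" "card K \<le> m" "K \<subseteq> H" "H = insert p K"
        using prems(2,3) p by (auto simp: K_def)
      \<comment> \<open>The signs of all coefficients fix the degrees and the signs of the leading
        coefficients.\<close>
      define B0 where "B0 = (\<lambda>(q, i) e. coeff (q e) i) ` ((F \<union> H) \<times> {..Suc D})"
      have B0: "finite B0" "\<forall>b\<in>B0. polyfun b"
        using prems(1,2,4) by (auto simp: B0_def polyfam_def)
      have degle: "degree (q e) \<le> Suc D" if "q \<in> F \<union> H" "e \<in> E" for q e
        using prems(5,6) that by (metis UnE less_imp_le)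
      define matched where "matched e e' \<longleftrightarrow> (\<exists>\<phi>. strict_mono \<phi> \<and> surj \<phi> \<and> (\<forall>q\<in>F \<union> H. sgn_match \<phi> (q e) (q e')))" for e e'
      \<comment> \<open>Pseudo-division needs constant degrees, so each class of parameters with
        equal \<open>B0\<close> signs is treated alone; the finitely many resulting sets are united
        at the end.\<close>
      have local: "\<exists>B. finite B \<and> (\<forall>b\<in>B. polyfun b) \<and> (\<forall>e\<in>E. \<forall>e'\<in>E. same_sgn B0 e e0 \<longrightarrow> same_sgn B0 e' e0 \<longrightarrow> same_sgn B e e' \<longrightarrow>
         matched e e')" if e0: "e0 \<in> E" for e0
      proof -
        define E0 where "E0 = {e \<in> E. same_sgn B0 e e0}"
        have coeff_sgn: "sgn (coeff (q e) i) = sgn (coeff (q e0) i)"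
          if "q \<in> F \<union> H" "e \<in> E0" "i \<le> Suc D" for q e i
        proof -
          have "(\<lambda>e. coeff (q e) i) \<in> B0"
            unfolding B0_def by (rule image_eqI[of _ _ "(q, i)"]) (use that in auto)
          then show ?thesis using that(2) by (auto simp: E0_def same_sgn_def)
        qed
        have deg: "degree (q e) = degree (q e0)" if "q \<in> F \<union> H" "e \<in> E0" for q e
        proof (rule degree_eq_if_same_coeff_zeros[of _ "Suc D"])
          show "degree (q e) \<le> Suc D" "degree (q e0) \<le> Suc D"
            using that e0 degle by (auto simp: E0_def)
          show "coeff (q e) i = 0 \<longleftrightarrow> coeff (q e0) i = 0" if "i \<le> Suc D" for i
            using coeff_sgn[of q e i] \<open>q \<in> F \<union> H\<close> \<open>e \<in> E0\<close> that by (metis sgn_zero_iff)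
        qed
        have "\<exists>B. finite B \<and> (\<forall>b\<in>B. polyfun b) \<and> (\<forall>e\<in>E0. \<forall>e'\<in>E0. same_sgn B e e' \<longrightarrow>
          matched e e')"
        proof (cases "degree (p e0) = Suc D")
          \<comment> \<open>On this class \<open>p\<close> stays below the top degree, so it moves
            from \<open>H\<close> to \<open>F\<close> and the count \<open>m\<close> drops.\<close>
          case False
          have "\<exists>B. finite B \<and> (\<forall>b\<in>B. polyfun b) \<and> (\<forall>e\<in>E0. \<forall>e'\<in>E0. same_sgn B e e' \<longrightarrow>
            (\<exists>\<phi>. strict_mono \<phi> \<and> surj \<phi> \<and> (\<forall>q\<in>insert p F \<union> K. sgn_match \<phi> (q e) (q e'))))"
          proof (rule IHm)
            show "degree (q e) < Suc D" if "q \<in> insert p F" "e \<in> E0" for q e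
              using that prems(5) deg[of p e] False degle[of p e] p by (auto simp: E0_def)
            show "degree (q e) \<le> Suc D" if "q \<in> K" "e \<in> E0" for q e
              using that K degle by (auto simp: E0_def)
          qed (use prems K in auto)
          then show ?thesis unfolding matched_def K(4) by simp
        next
          case True
          define p' where "p' e = pderiv (p e)" for e
          define G where "G = insert p' (F \<union> K)"
          have finG: "finite G" using prems K by (simp add: G_def)
          have polyG: "polyfam q" if "q \<in> G" for q
            using that prems(4) p K polyfam_pderiv[of p] by (auto simp: G_def p'_def[abs_def])
          have degG: "degree (q e) = degree (q e0)" "degree (q e) \<le> Suc D" if q: "q \<in> G" and e0': "e \<in> E0" for q e
          proof -
            have e: "e \<in> E" using e0' by (simp add: E0_def)
            consider "q = p'" | "q \<in> F \<union> H" using q K(3) by (auto simp: G_def)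
            then have "degree (q e) = degree (q e0) \<and> degree (q e) \<le> Suc D"
            proof cases
              case 1
              then show ?thesis using deg[of p e] e0' p True by (simp add: p'_def degree_pderiv)
            next
              case 2
              then show ?thesis using deg[OF 2 e0'] degle[OF 2 e] by simp
            qed
            then show "degree (q e) = degree (q e0)" "degree (q e) \<le> Suc D" by auto
          qed
          have "\<exists>r. polyfam r \<and> (\<forall>e\<in>E0. degree (r e) < degree (h e0) \<and>
            (\<exists>a>0. \<forall>x. poly (h e) x = 0 \<longrightarrow> poly (r e) x = a * poly (p e) x))"
            if "h \<in> G" "degree (h e0) > 0" for h
          proof (rule pseudo_remainder[where D = "Suc D"])
            show "degree (p e) \<le> Suc D" if "e \<in> E0" for e
              using that degle p by (auto simp: E0_def)
            show "polyfam p" using prems(4) p by auto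
          qed (use that polyG degG in auto)
          then obtain r where r: "\<And>h. h \<in> G \<Longrightarrow> degree (h e0) > 0 \<Longrightarrow> polyfam (r h) \<and> (\<forall>e\<in>E0. degree (r h e) < degree (h e0) \<and>
            (\<exists>a>0. \<forall>x. poly (h e) x = 0 \<longrightarrow> poly (r h e) x = a * poly (p e) x))"
            by metis
          \<comment> \<open>At a root of \<open>h\<close> the sign of \<open>p\<close> is the sign
            of its remainder modulo \<open>h\<close>. Constants are left out because a nonzero
            constant has no root.\<close>
          define N where "N = r ` {h \<in> G. degree (h e0) > 0}"
          have e0E0: "e0 \<in> E0" using e0 by (simp add: E0_def same_sgn_def)
          have "\<exists>B. finite B \<and> (\<forall>b\<in>B. polyfun b) \<and> (\<forall>e\<in>E0. \<forall>e'\<in>E0. same_sgn B e e' \<longrightarrow>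
            (\<exists>\<phi>. strict_mono \<phi> \<and> surj \<phi> \<and> (\<forall>q\<in>(insert p' F \<union> N) \<union> K. sgn_match \<phi> (q e) (q e'))))"
          proof (rule IHm)
            show "finite (insert p' F \<union> N)" using prems finG by (simp add: N_def)
            show "polyfam q" if "q \<in> insert p' F \<union> N \<union> K" for q
              using that polyG r by (auto simp: G_def N_def)
            show "degree (q e) < Suc D" if "q \<in> insert p' F \<union> N" and e: "e \<in> E0" for q e
              using that(1)
            proof (elim UnE insertE)
              assume "q = p'"
              then show ?thesis using deg[of p e] p e True by (simp add: p'_def degree_pderiv)
            next
              assume "q \<in> F"
              then show ?thesis using prems(5) e by (simp add: E0_def)
            next
              assume "q \<in> N"
              then obtain h where h: "h \<in> G" "degree (h e0) > 0" "q = r h" by (auto simp: N_def)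
              then show ?thesis using r[OF h(1,2)] e degG(2)[OF h(1) e0E0] by force
            qed
            show "degree (q e) \<le> Suc D" if "q \<in> K" "e \<in> E0" for q e
              using that K degle by (auto simp: E0_def)
          qed (use K in auto)
          then obtain B where B: "finite B" "\<forall>b\<in>B. polyfun b" and Bm: "\<forall>e\<in>E0. \<forall>e'\<in>E0. same_sgn B e e' \<longrightarrow>
            (\<exists>\<phi>. strict_mono \<phi> \<and> surj \<phi> \<and> (\<forall>q\<in>(insert p' F \<union> N) \<union> K. sgn_match \<phi> (q e) (q e')))"
            by (elim exE conjE)
          have "matched e e'"
            if e: "e \<in> E0" "e' \<in> E0" and ss: "same_sgn B e e'" for e e'
          proof -
            obtain \<phi> where \<phi>: "strict_mono \<phi>" "surj \<phi>" "\<And>q. q \<in> (insert p' F \<union> N) \<union> K \<Longrightarrow> sgn_match \<phi> (q e) (q e')"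
              using Bm[THEN bspec, OF e(1), THEN bspec, OF e(2), THEN mp, OF ss] by blast
            have mG: "sgn_match \<phi> (q e) (q e')" if "q \<in> G" for q
              using that \<phi>(3) by (auto simp: G_def)
            have dp: "degree (p e) = Suc D" "degree (p e') = Suc D"
              using deg e p True by auto
            have "\<exists>\<psi>. strict_mono \<psi> \<and> surj \<psi> \<and>
              (\<forall>(q, q')\<in>insert (p e, p e') ((\<lambda>q. (q e, q e')) ` G). sgn_match \<psi> q q')"
            proof (rule extend_sgn_match[OF \<phi>(1,2)])
              show "(pderiv (p e), pderiv (p e')) \<in> (\<lambda>q. (q e, q e')) ` G"
                by (rule image_eqI[of _ _ p']) (auto simp: p'_def G_def)
              show "sgn (lead_coeff (p e)) = sgn (lead_coeff (p e'))"
                using coeff_sgn[of p] e p by (simp add: dp)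
              fix q q' z assume q: "(q, q') \<in> (\<lambda>q. (q e, q e')) ` G" "q \<noteq> 0" "poly q z = 0"
              then obtain h where h: "h \<in> G" "q = h e" "q' = h e'" by auto
              have "degree (h e) > 0"
              proof (rule ccontr)
                assume "\<not> degree (h e) > 0"
                then obtain c where "h e = [:c:]" by (auto elim: degree_eq_zeroE)
                then show False using q h by simp
              qed
              then have h0: "degree (h e0) > 0" using degG(1)[OF h(1) e(1)] by simp
              then have "r h \<in> N" using h by (simp add: N_def)
              then have m: "sgn (poly (r h e) z) = sgn (poly (r h e') (\<phi> z))"
                using \<phi>(3) by (simp add: sgn_match_def)
              have z': "poly (h e') (\<phi> z) = 0"
                using q h sgn_match_zero_iff[OF mG[OF h(1)]] by simp
              obtain a where "a > 0" "poly (r h e) z = a * poly (p e) z"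
                using r[OF h(1) h0] e(1) q(3) h(2) by blast
              moreover obtain a' where "a' > 0" "poly (r h e') (\<phi> z) = a' * poly (p e') (\<phi> z)"
                using r[OF h(1) h0] e(2) z' by blast
              ultimately show "sgn (poly (p e) z) = sgn (poly (p e') (\<phi> z))"
                using m by (simp add: sgn_mult)
            qed (use finG mG dp in auto)
            then show ?thesis
              unfolding matched_def G_def using K(4) by (elim ex_forward) auto
          qed
          then show ?thesis using B by blast
        qed
        then show ?thesis
          unfolding E0_def by blast
      qed
      then obtain Bf where Bf: "\<And>e0. e0 \<in> E \<Longrightarrow> finite (Bf e0) \<and> (\<forall>b\<in>Bf e0. polyfun b) \<and>
        (\<forall>e\<in>E. \<forall>e'\<in>E. same_sgn B0 e e0 \<longrightarrow> same_sgn B0 e' e0 \<longrightarrow> same_sgn (Bf e0) e e' \<longrightarrow>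
         matched e e')"
        by metis
      obtain R where R: "R \<subseteq> E" "finite R" "\<And>e. e \<in> E \<Longrightarrow> \<exists>r\<in>R. same_sgn B0 e r"
        using same_sgn_finite_reps[OF B0(1), of E] by blast
      define B where "B = B0 \<union> (\<Union>r\<in>R. Bf r)"
      have "finite B" "\<forall>b\<in>B. polyfun b"
        using B0 R(1,2) Bf by (auto simp: B_def)
      moreover have "matched e e'"
        if e: "e \<in> E" "e' \<in> E" and ss: "same_sgn B e e'" for e e'
      proof -
        obtain r where r: "r \<in> R" "same_sgn B0 e r" using R(3)[OF e(1)] by blast
        moreover have "same_sgn B0 e' r" using r ss by (simp add: same_sgn_def B_def)
        moreover have "same_sgn (Bf r) e e'" using r ss by (auto simp: same_sgn_def B_def)
        ultimately show ?thesis using Bf[of r] R(1) e by blast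
      qed
      ultimately have "\<exists>B. finite B \<and> (\<forall>b\<in>B. polyfun b) \<and> (\<forall>e\<in>E. \<forall>e'\<in>E. same_sgn B e e' \<longrightarrow> matched e e')"
        by blast
      then show ?thesis unfolding matched_def .
    qed
  qed
qed

text \<open>Semialgebraic predicates: the truth value is determined by the signs of finitely many
  polynomials. This is equivalent to being a Boolean combination of polynomial inequalities.\<close>

definition SA :: "((nat \<Rightarrow> real) \<Rightarrow> bool) \<Rightarrow> bool" where
  "SA P \<longleftrightarrow> (\<exists>A. finite A \<and> (\<forall>a\<in>A. polyfun a) \<and> (\<forall>e e'. same_sgn A e e' \<longrightarrow> P e = P e'))"

section \<open>Closure of semialgebraic predicates under connectives and quantifiers\<close>

lemma SA_const: "SA (\<lambda>e. b)"
  unfolding SA_def by (intro exI[of _ "{}"]) auto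

lemma SA_not: "SA P \<Longrightarrow> SA (\<lambda>e. \<not> P e)"
  unfolding SA_def by simp

lemma SA_conj:
  assumes "SA P" "SA Q"
  shows "SA (\<lambda>e. P e \<and> Q e)"
proof -
  obtain A where A: "finite A" "\<forall>a\<in>A. polyfun a" "\<forall>e e'. same_sgn A e e' \<longrightarrow> P e = P e'"
    using assms(1) unfolding SA_def by blast
  obtain B where B: "finite B" "\<forall>a\<in>B. polyfun a" "\<forall>e e'. same_sgn B e e' \<longrightarrow> Q e = Q e'"
    using assms(2) unfolding SA_def by blast
  have "P e = P e' \<and> Q e = Q e'" if "same_sgn (A \<union> B) e e'" for e e'
    using that A(3) B(3) unfolding same_sgn_def by blast
  then show ?thesis
    unfolding SA_def using A(1,2) B(1,2) by (intro exI[of _ "A \<union> B"]) blast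
qed

lemma SA_disj:
  assumes "SA P" "SA Q"
  shows "SA (\<lambda>e. P e \<or> Q e)"
proof -
  have "SA (\<lambda>e. \<not> (\<not> P e \<and> \<not> Q e))"
    by (intro SA_not SA_conj assms)
  then show ?thesis by simp
qed

lemma SA_imp:
  assumes "SA P" "SA Q"
  shows "SA (\<lambda>e. P e \<longrightarrow> Q e)"
proof -
  have "SA (\<lambda>e. \<not> P e \<or> Q e)"
    by (intro SA_not SA_disj assms)
  then show ?thesis by simp
qed

lemma SA_all_finite: "finite I \<Longrightarrow> (\<And>i. i \<in> I \<Longrightarrow> SA (P i)) \<Longrightarrow> SA (\<lambda>e. \<forall>i\<in>I. P i e)"
proof (induction I rule: finite_induct)
  case empty
  show ?case by (simp add: SA_const)
next
  case (insert j I)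
  have "SA (\<lambda>e. P j e \<and> (\<forall>i\<in>I. P i e))"
    by (intro SA_conj insert) auto
  then show ?case by simp
qed

lemma SA_less:
  assumes "polyfun f" "polyfun g"
  shows "SA (\<lambda>e. f e < g e)"
proof -
  have "f e < g e \<longleftrightarrow> sgn (g e - f e) = 1" for e
    by (simp add: sgn_1_pos)
  then have "same_sgn {\<lambda>e. g e - f e} e e' \<Longrightarrow> f e < g e \<longleftrightarrow> f e' < g e'" for e e'
    by (simp add: same_sgn_def)
  then show ?thesis
    unfolding SA_def using polyfun_diff[OF assms(2,1)] by (intro exI[of _ "{\<lambda>e. g e - f e}"]) auto
qed

lemma SA_le:
  assumes "polyfun f" "polyfun g"
  shows "SA (\<lambda>e. f e \<le> g e)"
  using SA_not[OF SA_less[OF assms(2,1)]] by (simp add: not_less)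

lemma SA_eq:
  assumes "polyfun f" "polyfun g"
  shows "SA (\<lambda>e. f e = g e)"
  using SA_conj[OF SA_le[OF assms] SA_le[OF assms(2,1)]] by (simp add: eq_iff)

lemma SA_subst:
  assumes "SA P" and s: "\<And>k. polyfun (\<lambda>e. s e k)"
  shows "SA (\<lambda>e. P (s e))"
proof -
  obtain A where A: "finite A" "\<forall>a\<in>A. polyfun a" "\<And>e e'. same_sgn A e e' \<Longrightarrow> P e = P e'"
    using assms unfolding SA_def by blast
  have "polyfun (\<lambda>e. a (s e))" if "a \<in> A" for a
    using that A(2) s by (intro polyfun_subst[of a s]) auto
  moreover have "same_sgn ((\<lambda>a e. a (s e)) ` A) e e' \<longleftrightarrow> same_sgn A (s e) (s e')" for e e'
    by (auto simp: same_sgn_def)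
  ultimately show ?thesis
    unfolding SA_def using A(1,3) by (intro exI[of _ "(\<lambda>a e. a (s e)) ` A"]) auto
qed

text \<open>If two parameters have matching sign patterns, the matching map carries a witness for
  one to a witness for the other.\<close>

lemma SA_ex_case_nat:
  assumes "SA P"
  shows "SA (\<lambda>e. \<exists>x. P (case_nat x e))"
proof -
  obtain A where A: "finite A" "\<forall>a\<in>A. polyfun a" "\<And>e e'. same_sgn A e e' \<Longrightarrow> P e = P e'"
    using assms unfolding SA_def by blast
  then obtain q d where q: "\<And>a. a \<in> A \<Longrightarrow> polyfam (q a) \<and> (\<forall>e. degree (q a e) \<le> d a) \<and>
      (\<forall>e x. poly (q a e) x = a (case_nat x e))"
    using polyfun_as_poly by metis
  have deg: "degree (q a e) \<le> Max (d ` A)" if "a \<in> A" for a e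
    using q[OF that] A(1) that by (meson Max_ge finite_imageI imageI order_trans)
  have "\<exists>B. finite B \<and> (\<forall>b\<in>B. polyfun b) \<and> (\<forall>e\<in>UNIV. \<forall>e'\<in>UNIV. same_sgn B e e' \<longrightarrow>
    (\<exists>\<phi>. strict_mono \<phi> \<and> surj \<phi> \<and> (\<forall>f\<in>{} \<union> q ` A. sgn_match \<phi> (f e) (f e'))))"
    using A(1) q deg by (intro uniform_sgn_match[where m = "card (q ` A)" and D = "Max (d ` A)"]) auto
  then obtain B where B: "finite B" "\<forall>b\<in>B. polyfun b"
    and Bm: "\<And>e e'. same_sgn B e e' \<Longrightarrow> \<exists>\<phi>. \<forall>a\<in>A. sgn_match \<phi> (q a e) (q a e')"
    by auto metis
  have imp: "\<exists>x. P (case_nat x e')" if ss: "same_sgn B e e'" and ex: "\<exists>x. P (case_nat x e)" for e e'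
  proof -
    obtain x where x: "P (case_nat x e)" using ex by blast
    obtain \<phi> where "\<forall>a\<in>A. sgn_match \<phi> (q a e) (q a e')" using Bm[OF ss] by blast
    then have "same_sgn A (case_nat x e) (case_nat (\<phi> x) e')"
      using q by (auto simp: same_sgn_def sgn_match_def)
    then show ?thesis using A(3) x by blast
  qed
  have "(\<exists>x. P (case_nat x e)) = (\<exists>x. P (case_nat x e'))" if ss: "same_sgn B e e'" for e e'
  proof (rule iffI)
    have "same_sgn B e' e" using ss by (simp add: same_sgn_def)
    then show "\<exists>x. P (case_nat x e') \<Longrightarrow> \<exists>x. P (case_nat x e)" by (rule imp)
  qed (rule imp[OF ss])
  then show ?thesis
    unfolding SA_def using B by (intro exI[of _ B]) simp
qed

text \<open>Shaped for resolution: in the premise the bound variable is coordinate 0 and the free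
  ones are shifted by one.\<close>

lemma SA_ex:
  assumes "SA (\<lambda>e. Q (e 0) (\<lambda>k. e (Suc k)))"
  shows "SA (\<lambda>e. \<exists>x. Q x e)"
  using SA_ex_case_nat[OF assms] by simp

lemma SA_all:
  assumes "SA (\<lambda>e. Q (e 0) (\<lambda>k. e (Suc k)))"
  shows "SA (\<lambda>e. \<forall>x. Q x e)"
proof -
  have "SA (\<lambda>e. \<exists>x. \<not> Q x e)"
    by (rule SA_ex) (rule SA_not[OF assms])
  from SA_not[OF this] show ?thesis by simp
qed

text \<open>A polynomial in one variable has constant sign just to the right of 0, hence so has
  every truth value decided by finitely many signs. This germ at 0 is all the o-minimality that the
  later arguments use.\<close>

lemma SA_tame:
  assumes "SA (\<lambda>e. P (e 0))"
  shows "eventually P (at_right 0) \<or> eventually (\<lambda>t. \<not> P t) (at_right (0::real))"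
proof -
  obtain A where A: "finite A" "\<forall>a\<in>A. polyfun a" "\<And>e e'. same_sgn A e e' \<Longrightarrow> P (e 0) = P (e' 0)"
    using assms unfolding SA_def by blast
  \<comment> \<open>\<open>P\<close> looks at coordinate 0 alone; zeros elsewhere turn the deciding
    polynomials into univariate ones.\<close>
  define c where "c t = (\<lambda>i. case_nat t (\<lambda>_. 0::real) i)" for t :: real
  have "\<exists>\<sigma>. eventually (\<lambda>t. sgn (a (c t)) = \<sigma>) (at_right 0)" if "a \<in> A" for a
  proof -
    have "polyfun a" using A(2) that by blast
    from polyfun_as_poly[OF this] obtain f where "\<And>e x. poly (f e) x = a (case_nat x e)"
      by blast
    then have q: "\<And>x. poly (f (\<lambda>_. 0)) x = a (c x)"
      by (simp add: c_def)
    define q where "q = f (\<lambda>_. 0)"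
    note q = q[folded q_def]
    show ?thesis
    proof (cases "q = 0")
      case True
      then have "a (c t) = 0" for t using q[of t] by simp
      then show ?thesis by (intro exI[of _ 0]) simp
    next
      case False
      \<comment> \<open>The element 1 gives \<open>Min S\<close> a meaning when there is no positive
        root.\<close>
      define S where "S = insert 1 {x. poly q x = 0 \<and> x > 0}"
      have S: "finite S" "S \<noteq> {}"
        using poly_roots_finite[OF False] by (auto simp: S_def intro: finite_subset[rotated])
      then have "Min S > 0" by (auto simp: S_def)
      moreover have "sgn (a (c t)) = sgn (a (c (Min S / 2)))" if t: "0 < t" "t < Min S" for t
      proof -
        have "poly q z \<noteq> 0" if "0 < z" "z < Min S" for z
          using that S Min_le[OF S(1), of z] by (auto simp: S_def)
        then have "sgn (poly q (min t (Min S / 2))) = sgn (poly q (max t (Min S / 2)))"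
          using t by (intro sgn_poly_eq_if_no_zero) (auto simp: min_def max_def split: if_splits)
        then show ?thesis by (auto simp: q min_def max_def split: if_splits)
      qed
      ultimately show ?thesis
        unfolding eventually_at_right_field by blast
    qed
  qed
  then obtain \<sigma> where "\<And>a. a \<in> A \<Longrightarrow> eventually (\<lambda>t. sgn (a (c t)) = \<sigma> a) (at_right 0)"
    by metis
  then have ev: "eventually (\<lambda>t. \<forall>a\<in>A. sgn (a (c t)) = \<sigma> a) (at_right 0)"
    using A(1) by (simp add: eventually_ball_finite)
  then obtain t0 where t0: "\<forall>a\<in>A. sgn (a (c t0)) = \<sigma> a"
    using eventually_happens trivial_limit_at_right_real by blast
  have "eventually (\<lambda>t. P t = P t0) (at_right 0)"
    using ev
  proof eventually_elim
    case (elim t)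
    then have "same_sgn A (c t) (c t0)" using t0 by (simp add: same_sgn_def)
    then show ?case using A(3)[of "c t" "c t0"] by (simp add: c_def)
  qed
  then show ?thesis
    by (cases "P t0") (auto elim: eventually_mono)
qed

section \<open>Definable functions of one variable\<close>

lemma SA_sgn:
  assumes "polyfun p"
  shows "SA (\<lambda>e. sgn (p e) = \<sigma>)"
  unfolding SA_def using assms by (intro exI[of _ "{p}"]) (auto simp: same_sgn_def)

definition dfun :: "(real \<Rightarrow> real) \<Rightarrow> bool" where
  "dfun h \<longleftrightarrow> SA (\<lambda>e. e 1 = h (e 0))"

text \<open>A value of \<open>h\<close> cannot be substituted as a polynomial, so it is named by an
  extra existentially quantified variable tied to it by the graph of \<open>h\<close>.\<close>

lemma SA_dfun:
  assumes h: "dfun h" and p: "polyfun p" and Q: "SA (\<lambda>e. Q (e 0) (\<lambda>k. e (Suc k)))"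
  shows "SA (\<lambda>e. Q (h (p e)) e)"
proof -
  have p': "polyfun (\<lambda>e. p (\<lambda>k. e (Suc k)))"
    by (rule polyfun_subst[OF p]) (rule polyfun.var)
  have "SA (\<lambda>e. (if 1 = (1::nat) then e 0 else p (\<lambda>k. e (Suc k))) = h (if 0 = (1::nat) then e 0 else p (\<lambda>k. e (Suc k))))"
    by (rule SA_subst[OF h[unfolded dfun_def], of "\<lambda>e k. if k = 1 then e 0 else p (\<lambda>k. e (Suc k))"])
      (intro polyfun_intros p')
  then have "SA (\<lambda>e. e 0 = h (p (\<lambda>k. e (Suc k))))"
    by simp
  then have "SA (\<lambda>e. \<exists>u. u = h (p e) \<and> Q u e)"
    by (intro SA_ex SA_conj Q)
  then show ?thesis by simp
qed

lemma SA_dfun2: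
  assumes h: "dfun h" and p: "polyfun p" and q: "polyfun q"
    and Q: "SA (\<lambda>e. Q (e 1) (e 0) (\<lambda>k. e (Suc (Suc k))))"
  shows "SA (\<lambda>e. Q (h (p e)) (h (q e)) e)"
proof (rule SA_dfun[OF h p, of "\<lambda>u e. Q u (h (q e)) e"])
  have "polyfun (\<lambda>e. q (\<lambda>k. e (Suc k)))"
    by (rule polyfun_subst[OF q]) (rule polyfun.var)
  from SA_dfun[OF h this, of "\<lambda>v e. Q (e 0) v (\<lambda>k. e (Suc k))"] Q
  show "SA (\<lambda>e. Q (e 0) (h (q (\<lambda>k. e (Suc k)))) (\<lambda>k. e (Suc k)))"
    by simp
qed

text \<open>\<^term>\<open>c = 1\<close> looks to the right of \<^term>\<open>t\<close>, \<^term>\<open>c = - 1\<close> to the left.\<close>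

definition side_sgn :: "(real \<Rightarrow> real) \<Rightarrow> real \<Rightarrow> real \<Rightarrow> real \<Rightarrow> bool" where
  "side_sgn h c \<sigma> t \<longleftrightarrow> (\<exists>b>0. \<forall>s>0. s < b \<longrightarrow> sgn (h (t + c * s) - h t) = \<sigma>)"

lemma SA_side_sgn:
  assumes "dfun h"
  shows "SA (\<lambda>e. side_sgn h c \<sigma> (e 0))"
  unfolding side_sgn_def
proof (intro SA_ex SA_all SA_conj SA_imp SA_less polyfun_intros)
  show "SA (\<lambda>e. sgn (h (e (Suc (Suc 0)) + c * e 0) - h (e (Suc (Suc 0)))) = \<sigma>)"
    by (rule SA_dfun2[OF assms, of "\<lambda>e. e (Suc (Suc 0)) + c * e 0" "\<lambda>e. e (Suc (Suc 0))" "\<lambda>u v e. sgn (u - v) = \<sigma>"])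
      (intro polyfun_intros SA_sgn)+
qed

lemma sgn_real_cases: "sgn x = 1 \<or> sgn x = 0 \<or> sgn x = - 1" for x :: real
  by (simp add: sgn_if)

lemma side_sgn_cases:
  assumes "dfun h"
  shows "side_sgn h c 1 t \<or> side_sgn h c 0 t \<or> side_sgn h c (- 1) t"
proof (rule ccontr)
  assume no: "\<not> ?thesis"
  have *: "eventually (\<lambda>s. sgn (h (t + c * s) - h t) \<noteq> \<sigma>) (at_right 0)" if "\<not> side_sgn h c \<sigma> t" for \<sigma>
  proof -
    have "SA (\<lambda>e. sgn (h (t + c * e 0) - h t) = \<sigma>)"
      by (rule SA_dfun[OF assms, of "\<lambda>e. t + c * e 0" "\<lambda>u e. sgn (u - h t) = \<sigma>"])
        (intro polyfun_intros SA_sgn)+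
    from SA_tame[OF this] show ?thesis
      using that unfolding side_sgn_def eventually_at_right_field by auto
  qed
  have "eventually (\<lambda>s. False) (at_right (0::real))"
  proof -
    have "\<not> side_sgn h c 1 t" "\<not> side_sgn h c 0 t" "\<not> side_sgn h c (- 1) t" using no by auto
    from this[THEN *] show ?thesis
    proof eventually_elim
      case (elim s)
      then show ?case using sgn_real_cases[of "h (t + c * s) - h t"] by auto
    qed
  qed
  then show False by simp
qed

lemma eventually_side_sgn:
  assumes "dfun h"
  shows "\<exists>\<sigma>\<in>{1, 0, - 1}. eventually (side_sgn h c \<sigma>) (at_right 0)"
proof (rule ccontr)
  assume "\<not> ?thesis"
  then have "eventually (\<lambda>t. \<not> side_sgn h c \<sigma> t) (at_right 0)" if "\<sigma> \<in> {1, 0, - 1}" for \<sigma>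
    using SA_tame[OF SA_side_sgn[OF assms]] that by blast
  then have "eventually (\<lambda>t. \<not> side_sgn h c 1 t) (at_right 0)" "eventually (\<lambda>t. \<not> side_sgn h c 0 t) (at_right 0)"
    "eventually (\<lambda>t. \<not> side_sgn h c (- 1) t) (at_right 0)" by auto
  then have "eventually (\<lambda>t. False) (at_right (0::real))"
    by eventually_elim (use side_sgn_cases[OF assms] in blast)
  then show False by simp
qed

text \<open>Interval induction: on a short interval around \<open>z\<close> the end values are
  compared through \<open>h z\<close>.\<close>

lemma locally_mono_imp_mono_on:
  fixes h :: "real \<Rightarrow> real"
  assumes right: "\<And>t. t \<in> {l<..<r} \<Longrightarrow> \<exists>b>0. \<forall>s>0. s < b \<longrightarrow> h t \<le> h (t + s)"
    and left: "\<And>t. t \<in> {l<..<r} \<Longrightarrow> \<exists>b>0. \<forall>s>0. s < b \<longrightarrow> h (t - s) \<le> h t"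
  shows "mono_on {l<..<r} h"
proof (rule mono_onI)
  fix x y assume xy: "x \<in> {l<..<r}" "y \<in> {l<..<r}" "x \<le> y"
  show "h x \<le> h y"
    using \<open>x \<le> y\<close>
  proof (induction rule: Bolzano)
    case (local z)
    then have z: "z \<in> {l<..<r}" using xy by auto
    obtain b where b: "b > 0" "\<And>s. 0 < s \<Longrightarrow> s < b \<Longrightarrow> h z \<le> h (z + s)" using right[OF z] by blast
    obtain c where c: "c > 0" "\<And>s. 0 < s \<Longrightarrow> s < c \<Longrightarrow> h (z - s) \<le> h z" using left[OF z] by blast
    show ?case
    proof (intro exI[of _ "min b c"] conjI allI impI)
      fix u v assume uv: "u \<le> z \<and> z \<le> v \<and> v - u < min b c"
      have "h u \<le> h z" using c(2)[of "z - u"] uv by (cases "u = z") auto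
      moreover have "h z \<le> h v" using b(2)[of "v - z"] uv by (cases "v = z") auto
      ultimately show "h u \<le> h v" by simp
    qed (use b c in auto)
  qed auto
qed

text \<open>Each such point is the unique minimiser of \<open>h\<close> on an interval with rational
  end points, so the interval determines the point.\<close>

lemma countable_strict_local_minima:
  fixes h :: "real \<Rightarrow> real"
  shows "countable {t. side_sgn h 1 1 t \<and> side_sgn h (- 1) 1 t}" (is "countable ?S")
proof -
  define W where "W t p \<longleftrightarrow> p \<in> \<rat> \<times> \<rat> \<and> fst p < t \<and> t < snd p \<and>
    (\<forall>s. fst p < s \<and> s < snd p \<and> s \<noteq> t \<longrightarrow> h t < h s)" for t p
  have "\<exists>p. W t p" if t: "t \<in> ?S" for t
  proof -
    obtain b where b: "b > 0" "\<And>s. 0 < s \<Longrightarrow> s < b \<Longrightarrow> sgn (h (t + s) - h t) = 1"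
      using t unfolding side_sgn_def by auto
    obtain c where c: "c > 0" "\<And>s. 0 < s \<Longrightarrow> s < c \<Longrightarrow> sgn (h (t - s) - h t) = 1"
      using t unfolding side_sgn_def by auto
    obtain u where u: "u \<in> \<rat>" "t - c < u" "u < t"
      using Rats_dense_in_real[of "t - c" t] c(1) by auto
    obtain v where v: "v \<in> \<rat>" "t < v" "v < t + b"
      using Rats_dense_in_real[of t "t + b"] b(1) by auto
    have "h t < h s" if "u < s" "s < v" "s \<noteq> t" for s
    proof (cases "t < s")
      case True
      then have "sgn (h s - h t) = 1" using b(2)[of "s - t"] that v by simp
      then show ?thesis by (simp add: sgn_1_pos)
    next
      case False
      then have "sgn (h s - h t) = 1" using c(2)[of "t - s"] that u by simp
      then show ?thesis by (simp add: sgn_1_pos)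
    qed
    then have "W t (u, v)" using u v by (simp add: W_def)
    then show ?thesis by blast
  qed
  then have "\<forall>t\<in>?S. \<exists>p. W t p" by blast
  from bchoice[OF this] obtain f where f: "\<And>t. t \<in> ?S \<Longrightarrow> W t (f t)" by blast
  have "f ` ?S \<subseteq> \<rat> \<times> \<rat>"
  proof (rule image_subsetI)
    show "f t \<in> \<rat> \<times> \<rat>" if "t \<in> ?S" for t
      using f[OF that] unfolding W_def by blast
  qed
  then have "countable (f ` ?S)"
    by (rule countable_subset) (intro countable_SIGMA countable_rat)
  moreover have "inj_on f ?S"
  proof (rule inj_onI, rule ccontr)
    fix s t assume st: "s \<in> ?S" "t \<in> ?S" "f s = f t" "s \<noteq> t"
    have s: "W s (f t)" and t: "W t (f t)" using f[OF st(1)] f[OF st(2)] st(3) by simp_all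
    have "h t < h s" using s t st(4) unfolding W_def by blast
    moreover have "h s < h t" using s t st(4) unfolding W_def by blast
    ultimately show False by simp
  qed
  ultimately show ?thesis by (rule countable_image_inj_on)
qed

lemma side_sgn_uminus: "side_sgn (\<lambda>t. - h t) c \<sigma> t \<longleftrightarrow> side_sgn h c (- \<sigma>) t"
proof -
  have "sgn (- h (t + c * s) - - h t) = - sgn (h (t + c * s) - h t)" for s
    by (metis minus_diff_minus sgn_minus)
  then have "sgn (- h (t + c * s) - - h t) = \<sigma> \<longleftrightarrow> sgn (h (t + c * s) - h t) = - \<sigma>" for s
    by (metis minus_equation_iff)
  then show ?thesis by (simp add: side_sgn_def)
qed

lemma side_sgn_imp_mono_on:
  assumes "\<And>t. t \<in> {0<..<r} \<Longrightarrow> side_sgn h 1 \<sigma> t" "\<And>t. t \<in> {0<..<r} \<Longrightarrow> side_sgn h (- 1) \<tau> t" "\<sigma> \<ge> 0" "\<tau> \<le> 0"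
  shows "mono_on {0<..<r} h"
proof (rule locally_mono_imp_mono_on)
  fix t assume t: "t \<in> {0<..<r}"
  obtain b where b: "b > 0" "\<And>s. 0 < s \<Longrightarrow> s < b \<Longrightarrow> sgn (h (t + s) - h t) = \<sigma>"
    using assms(1)[OF t] unfolding side_sgn_def by auto
  obtain c where c: "c > 0" "\<And>s. 0 < s \<Longrightarrow> s < c \<Longrightarrow> sgn (h (t - s) - h t) = \<tau>"
    using assms(2)[OF t] unfolding side_sgn_def by auto
  have "h t \<le> h (t + s)" if "0 < s" "s < b" for s
    using b(2)[OF that] assms(3) by (metis diff_ge_0_iff_ge zero_le_sgn_iff)
  then show "\<exists>b>0. \<forall>s>0. s < b \<longrightarrow> h t \<le> h (t + s)" using b(1) by blast
  have "h (t - s) \<le> h t" if "0 < s" "s < c" for s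
    using c(2)[OF that] assms(4) by (metis diff_le_0_iff_le sgn_le_0_iff)
  then show "\<exists>b>0. \<forall>s>0. s < b \<longrightarrow> h (t - s) \<le> h t" using c(1) by blast
qed

lemma SA_isCont:
  assumes "dfun h"
  shows "SA (\<lambda>e. isCont h (e 0))"
proof -
  \<comment> \<open>Spelled out so that only linear inequalities in two values of \<open>h\<close>
    occur, the form that \<open>SA_dfun2\<close> accepts.\<close>
  have iff: "isCont h t \<longleftrightarrow> (\<forall>\<epsilon>. 0 < \<epsilon> \<longrightarrow> (\<exists>\<delta>. 0 < \<delta> \<and> (\<forall>s. t - \<delta> < s \<and> s < t + \<delta> \<longrightarrow> h s - h t < \<epsilon> \<and> h t - h s < \<epsilon>)))" for t
    unfolding continuous_at_real_range abs_less_iff by (simp add: algebra_simps) (smt (verit))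
  show ?thesis
    unfolding iff
  proof (intro SA_ex SA_all SA_conj SA_imp)
    let ?s = "\<lambda>e. e 0 :: real" and ?t = "\<lambda>e. e (Suc (Suc (Suc 0))) :: real" and ?\<epsilon> = "\<lambda>e. e (Suc (Suc 0)) :: real"
    show "SA (\<lambda>e. h (?s e) - h (?t e) < ?\<epsilon> e)"
      by (rule SA_dfun2[OF assms, of ?s ?t "\<lambda>u v e. u - v < ?\<epsilon> e"]) (intro polyfun_intros SA_less)+
    show "SA (\<lambda>e. h (?t e) - h (?s e) < ?\<epsilon> e)"
      by (rule SA_dfun2[OF assms, of ?t ?s "\<lambda>u v e. u - v < ?\<epsilon> e"]) (intro polyfun_intros SA_less)+
  qed (intro SA_less polyfun_intros)+
qed

text \<open>Near 0 the right and left signs are constant. Only the pairs (1, 1) and (-1, -1)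
  obstruct monotonicity, and they would make every point of an interval a strict local extremum,
  against countability. A monotone function has countably many discontinuities, so tameness gives
  continuity at every point near 0.\<close>

theorem dfun_eventually_monotone:
  assumes "dfun h"
  shows "\<exists>r>0. (\<forall>t\<in>{0<..<r}. isCont h t) \<and> (mono_on {0<..<r} h \<or> mono_on {0<..<r} (\<lambda>t. - h t))"
proof -
  obtain \<sigma> \<tau> where st: "\<sigma> \<in> {1, 0, - 1}" "\<tau> \<in> {1, 0, - 1}" "eventually (side_sgn h 1 \<sigma>) (at_right 0)"
    "eventually (side_sgn h (- 1) \<tau>) (at_right 0)"
    using eventually_side_sgn[OF assms] by meson
  then obtain a b where ab: "a > 0" "\<And>t. 0 < t \<Longrightarrow> t < a \<Longrightarrow> side_sgn h 1 \<sigma> t"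
     "b > 0" "\<And>t. 0 < t \<Longrightarrow> t < b \<Longrightarrow> side_sgn h (- 1) \<tau> t"
    unfolding eventually_at_right_field by (elim exE conjE) blast
  define r where "r = min a b"
  have r: "r > 0" "\<And>t. t \<in> {0<..<r} \<Longrightarrow> side_sgn h 1 \<sigma> t" "\<And>t. t \<in> {0<..<r} \<Longrightarrow> side_sgn h (- 1) \<tau> t"
    using ab by (auto simp: r_def)
  have unc: "\<not> countable {0<..<r'}" if "r' > 0" for r' :: real
    using that by (simp add: uncountable_open_interval)
  have "\<not> (\<sigma> = 1 \<and> \<tau> = 1)"
  proof
    assume "\<sigma> = 1 \<and> \<tau> = 1"
    then have "{0<..<r} \<subseteq> {t. side_sgn h 1 1 t \<and> side_sgn h (- 1) 1 t}"
      using r by auto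
    from countable_subset[OF this countable_strict_local_minima] show False using unc[OF r(1)] by simp
  qed
  moreover have "\<not> (\<sigma> = - 1 \<and> \<tau> = - 1)"
  proof
    assume "\<sigma> = - 1 \<and> \<tau> = - 1"
    then have "{0<..<r} \<subseteq> {t. side_sgn (\<lambda>t. - h t) 1 1 t \<and> side_sgn (\<lambda>t. - h t) (- 1) 1 t}"
      using r by (auto simp: side_sgn_uminus)
    from countable_subset[OF this countable_strict_local_minima] show False using unc[OF r(1)] by simp
  qed
  ultimately consider "\<sigma> \<ge> 0" "\<tau> \<le> 0" | "\<sigma> \<le> 0" "\<tau> \<ge> 0"
    using st(1,2) by auto
  then have mono: "mono_on {0<..<r} h \<or> mono_on {0<..<r} (\<lambda>t. - h t)"
  proof cases
    case 1
    then show ?thesis using side_sgn_imp_mono_on[of r h \<sigma> \<tau>] r by blast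
  next
    case 2
    then have "mono_on {0<..<r} (\<lambda>t. - h t)"
      using r by (intro side_sgn_imp_mono_on[of r "\<lambda>t. - h t" "- \<sigma>" "- \<tau>"]) (auto simp: side_sgn_uminus)
    then show ?thesis by blast
  qed
  have "countable {t \<in> {0<..<r}. \<not> isCont h t}"
    using mono
  proof
    assume "mono_on {0<..<r} h"
    then show ?thesis by (intro mono_on_ctble_discont_open) auto
  next
    assume *: "mono_on {0<..<r} (\<lambda>t. - h t)"
    have "isCont (\<lambda>t. - h t) t \<longleftrightarrow> isCont h t" for t
      using continuous_minus[of "at t" h] continuous_minus[of "at t" "\<lambda>t. - h t"]
      unfolding minus_minus by blast
    then show ?thesis
      using mono_on_ctble_discont_open[OF open_greaterThanLessThan *] by simp
  qed
  note count = this
  have "\<not> eventually (\<lambda>t. \<not> isCont h t) (at_right 0)"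
  proof
    assume "eventually (\<lambda>t. \<not> isCont h t) (at_right 0)"
    then obtain d where d: "d > 0" "\<And>t. 0 < t \<Longrightarrow> t < d \<Longrightarrow> \<not> isCont h t"
      unfolding eventually_at_right_field by blast
    then have "{0<..<min r d} \<subseteq> {t \<in> {0<..<r}. \<not> isCont h t}" by auto
    from countable_subset[OF this count] show False using unc[of "min r d"] r(1) d(1) by simp
  qed
  then have "eventually (isCont h) (at_right 0)"
    using SA_tame[OF SA_isCont[OF assms]] by blast
  then obtain d where d: "d > 0" "\<And>t. 0 < t \<Longrightarrow> t < d \<Longrightarrow> isCont h t"
    unfolding eventually_at_right_field by blast
  have "mono_on {0<..<min r d} f" if "mono_on {0<..<r} f" for f :: "real \<Rightarrow> real"
    using that by (rule mono_on_subset) auto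
  then show ?thesis
    using mono d r(1) by (intro exI[of _ "min r d"]) auto
qed

section \<open>Definable choice and the talweg inequality\<close>

text \<open>Points with \<open>M\<close> coordinates are functions padded with zeros: equality of
  points is equality of functions, polynomials apply to them directly, and compactness is that of
  the product topology.\<close>

definition coords :: "nat \<Rightarrow> (nat \<Rightarrow> real) set" where
  "coords M = {x. \<forall>k\<ge>M. x k = 0}"

definition trunc :: "nat \<Rightarrow> (nat \<Rightarrow> real) \<Rightarrow> nat \<Rightarrow> real" where
  "trunc M e = (\<lambda>k. if k < M then e k else 0)"

lemma trunc_in_coords [simp]: "trunc M e \<in> coords M"
  by (simp add: trunc_def coords_def)

lemma trunc_cong: "(\<And>k. k < M \<Longrightarrow> e k = e' k) \<Longrightarrow> trunc M e = trunc M e'"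
  by (auto simp: trunc_def)

lemma polyfun_trunc: "(\<And>k. polyfun (\<lambda>e. s e k)) \<Longrightarrow> polyfun (\<lambda>e. trunc M (s e) k)"
  unfolding trunc_def by (intro polyfun_if polyfun.const)

lemma polyfun_comp_trunc: "polyfun f \<Longrightarrow> (\<And>k. polyfun (\<lambda>e. s e k)) \<Longrightarrow> polyfun (\<lambda>e. f (trunc M (s e)))"
  by (rule polyfun_subst[of f "\<lambda>e. trunc M (s e)"]) (auto intro: polyfun_trunc)

lemma ex_coords_Suc: "(\<exists>x\<in>coords (Suc M). R x) \<longleftrightarrow> (\<exists>u. \<exists>x\<in>coords M. R (x(M := u)))"
proof
  assume "\<exists>x\<in>coords (Suc M). R x"
  then obtain x where x: "x \<in> coords (Suc M)" "R x" by blast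
  have "x(M := 0) \<in> coords M" using x(1) by (auto simp: coords_def)
  moreover have "R ((x(M := 0))(M := x M))" using x(2) by simp
  ultimately show "\<exists>u. \<exists>x\<in>coords M. R (x(M := u))" by blast
next
  assume "\<exists>u. \<exists>x\<in>coords M. R (x(M := u))"
  then obtain u x where x: "x \<in> coords M" "R (x(M := u))" by blast
  then have "x(M := u) \<in> coords (Suc M)" by (auto simp: coords_def)
  then show "\<exists>x\<in>coords (Suc M). R x" using x(2) by blast
qed

text \<open>In the premise the quantified point fills coordinates below \<open>M\<close> and the old
  parameters are shifted by \<open>M\<close>. The induction binds the last coordinate
  outermost.\<close>

lemma SA_ex_coords:
  assumes "SA (\<lambda>e. Q (trunc M e) (\<lambda>k. e (M + k)))"
  shows "SA (\<lambda>e. \<exists>x\<in>coords M. Q x e)"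
  using assms
proof (induction M arbitrary: Q)
  case 0
  have "coords 0 = {\<lambda>_. 0}" by (auto simp: coords_def)
  then show ?case using 0 by (simp add: trunc_def)
next
  case (Suc M)
  have *: "(trunc M e)(M := e M) = trunc (Suc M) e" for e
    by (auto simp: trunc_def fun_eq_iff less_Suc_eq)
  have "SA (\<lambda>e. \<exists>x\<in>coords M. Q (x(M := e 0)) (\<lambda>k. e (Suc k)))"
    by (rule Suc.IH[of "\<lambda>x e. Q (x(M := e 0)) (\<lambda>k. e (Suc k))"]) (use Suc.prems in \<open>simp add: *\<close>)
  then have "SA (\<lambda>e. \<exists>u. \<exists>x\<in>coords M. Q (x(M := u)) e)"
    by (rule SA_ex[of "\<lambda>u e. \<exists>x\<in>coords M. Q (x(M := u)) e"])
  then show ?case by (simp add: ex_coords_Suc)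
qed

lemma SA_all_coords:
  assumes "SA (\<lambda>e. Q (trunc M e) (\<lambda>k. e (M + k)))"
  shows "SA (\<lambda>e. \<forall>x\<in>coords M. Q x e)"
proof -
  have "SA (\<lambda>e. \<exists>x\<in>coords M. \<not> Q x e)"
    by (rule SA_ex_coords) (rule SA_not[OF assms])
  from SA_not[OF this] show ?thesis by simp
qed

text \<open>The parameter sits in coordinate \<^term>\<open>M\<close>, right after the point, so that
  eliminating a quantifier over points moves it to the front.\<close>

definition dfam :: "nat \<Rightarrow> (real \<Rightarrow> (nat \<Rightarrow> real) set) \<Rightarrow> bool" where
  "dfam M B \<longleftrightarrow> (\<forall>t. B t \<subseteq> coords M) \<and> SA (\<lambda>e. trunc M e \<in> B (e M))"

lemma SA_dfam:
  assumes "dfam M B" "\<And>k. polyfun (\<lambda>e. s e k)" "polyfun p"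
  shows "SA (\<lambda>e. trunc M (s e) \<in> B (p e))"
proof -
  have "SA (\<lambda>e. trunc M (\<lambda>k. if k = M then p e else s e k) \<in> B (if M = M then p e else s e M))"
    by (rule SA_subst[of "\<lambda>e. trunc M e \<in> B (e M)" "\<lambda>e k. if k = M then p e else s e k"])
      (use assms in \<open>auto simp: dfam_def intro: polyfun_if\<close>)
  moreover have "trunc M (\<lambda>k. if k = M then p e else s e k) = trunc M (s e)" for e
    by (rule trunc_cong) simp
  ultimately show ?thesis by simp
qed

section \<open>Definable choice by lexicographic minima\<close>

definition argmin_on :: "((nat \<Rightarrow> real) \<Rightarrow> real) \<Rightarrow> (nat \<Rightarrow> real) set \<Rightarrow> (nat \<Rightarrow> real) set" where
  "argmin_on g S = {x \<in> S. \<forall>y\<in>S. g x \<le> g y}"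

lemma argmin_on_subset: "argmin_on g S \<subseteq> S"
  by (auto simp: argmin_on_def)

lemma dfam_argmin:
  assumes B: "dfam M B" and g: "polyfun g"
  shows "dfam M (\<lambda>t. argmin_on g (B t))"
proof -
  have sub: "B t \<subseteq> coords M" for t using B by (simp add: dfam_def)
  have "SA (\<lambda>e. \<forall>y\<in>coords M. y \<in> B (e M) \<longrightarrow> g (trunc M e) \<le> g y)"
  proof (rule SA_all_coords, rule SA_imp)
    \<comment> \<open>The new point \<open>y\<close> occupies the first \<open>M\<close>
      coordinates, so the old point starts at \<open>M\<close> and the parameter has moved to
      \<open>M + M\<close>.\<close>
    show "SA (\<lambda>e. trunc M e \<in> B (e (M + M)))"
      by (rule SA_dfam[OF B, of "\<lambda>e. e" "\<lambda>e. e (M + M)"]) (auto intro: polyfun.var)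
    show "SA (\<lambda>e. g (trunc M (\<lambda>k. e (M + k))) \<le> g (trunc M e))"
      by (intro SA_le polyfun_comp_trunc g polyfun.var)
  qed
  then have "SA (\<lambda>e. trunc M e \<in> B (e M) \<and> (\<forall>y\<in>coords M. y \<in> B (e M) \<longrightarrow> g (trunc M e) \<le> g y))"
    using B by (intro SA_conj) (auto simp: dfam_def)
  moreover have "(trunc M e \<in> B (e M) \<and> (\<forall>y\<in>coords M. y \<in> B (e M) \<longrightarrow> g (trunc M e) \<le> g y)) \<longleftrightarrow>
      trunc M e \<in> argmin_on g (B (e M))" for e
    using sub[of "e M"] by (auto simp: argmin_on_def)
  ultimately have "SA (\<lambda>e. trunc M e \<in> argmin_on g (B (e M)))" by simp
  moreover have "argmin_on g (B t) \<subseteq> coords M" for t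
    using sub[of t] argmin_on_subset[of g "B t"] by (rule subset_trans[rotated])
  ultimately show ?thesis
    unfolding dfam_def by simp
qed

lemma continuous_on_polyfun: "polyfun f \<Longrightarrow> continuous_on S f"
  by (induction rule: polyfun.induct)
    (auto intro!: continuous_intros continuous_on_subset[OF continuous_on_product_coordinates])

lemma compact_argmin_on:
  assumes "compact S" "S \<noteq> {}" "polyfun g"
  shows "compact (argmin_on g S)" "argmin_on g S \<noteq> {}"
proof -
  obtain x where x: "x \<in> S" "\<forall>y\<in>S. g x \<le> g y"
    using continuous_attains_inf[OF assms(1,2) continuous_on_polyfun[OF assms(3)]] by blast
  then show "argmin_on g S \<noteq> {}" by (auto simp: argmin_on_def)
  have "argmin_on g S = S \<inter> {y. g y \<le> g x}"
    using x by (auto simp: argmin_on_def intro: order_trans)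
  moreover have "closed {y. g y \<le> g x}"
    by (intro closed_Collect_le continuous_on_polyfun assms continuous_on_const)
  ultimately show "compact (argmin_on g S)"
    using assms(1) by (simp add: compact_Int_closed)
qed

primrec lexmin :: "(nat \<Rightarrow> real) set \<Rightarrow> nat \<Rightarrow> (nat \<Rightarrow> real) set" where
  "lexmin S 0 = S"
| "lexmin S (Suc j) = argmin_on (\<lambda>x. x j) (lexmin S j)"

lemma dfam_lexmin: "dfam M B \<Longrightarrow> dfam M (\<lambda>t. lexmin (B t) j)"
  by (induction j) (auto intro: dfam_argmin polyfun.var)

lemma compact_lexmin: "compact S \<Longrightarrow> S \<noteq> {} \<Longrightarrow> compact (lexmin S j) \<and> lexmin S j \<noteq> {}"
  by (induction j) (simp_all add: compact_argmin_on polyfun.var)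

lemma lexmin_antimono: "i \<le> j \<Longrightarrow> lexmin S j \<subseteq> lexmin S i"
proof (induction j)
  case (Suc j)
  then show ?case
    using argmin_on_subset[of "\<lambda>x. x j" "lexmin S j"] by (cases "i = Suc j") auto
qed simp

lemma lexmin_unique:
  assumes "S \<subseteq> coords M" "x \<in> lexmin S M" "y \<in> lexmin S M"
  shows "x = y"
proof
  fix k
  show "x k = y k"
  proof (cases "k < M")
    case True
    then have "x \<in> lexmin S (Suc k)" "y \<in> lexmin S (Suc k)"
      using lexmin_antimono[of "Suc k" M S] assms by auto
    then show ?thesis by (auto simp: argmin_on_def intro: antisym)
  next
    case False
    have "x \<in> coords M" "y \<in> coords M" using lexmin_antimono[of 0 M S] assms by auto
    then show ?thesis using False by (simp add: coords_def)
  qed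
qed

text \<open>Minimising the coordinates one after the other singles out one point of a compact set,
  and each minimisation is first-order expressible. Thus \<open>SOME\<close> picks from a singleton,
  and the choice has a semialgebraic graph.\<close>

lemma definable_choice:
  assumes B: "dfam M B" and comp: "\<And>t. compact (B t)" "\<And>t. B t \<noteq> {}"
  obtains x where "\<And>t. x t \<in> B t" "\<And>p. polyfun p \<Longrightarrow> dfun (\<lambda>t. p (x t))"
proof -
  define x where "x t = (SOME y. y \<in> lexmin (B t) M)" for t
  have xL: "x t \<in> lexmin (B t) M" for t
    unfolding x_def using compact_lexmin[OF comp(1) comp(2)] by (metis ex_in_conv someI_ex)
  have sub: "B t \<subseteq> coords M" for t using B by (simp add: dfam_def)
  have xB: "x t \<in> B t" for t
    using xL lexmin_antimono[of 0 M "B t"] by auto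
  have "dfun (\<lambda>t. p (x t))" if p: "polyfun p" for p
  proof -
    have "SA (\<lambda>e. \<exists>y\<in>coords M. y \<in> lexmin (B (e 0)) M \<and> e 1 = p y)"
    proof (rule SA_ex_coords, rule SA_conj)
      show "SA (\<lambda>e. trunc M e \<in> lexmin (B (e (M + 0))) M)"
        by (rule SA_dfam[OF dfam_lexmin[OF B], of "\<lambda>e. e" "\<lambda>e. e (M + 0)"]) (auto intro: polyfun.var)
      show "SA (\<lambda>e. e (M + 1) = p (trunc M e))"
        by (intro SA_eq polyfun_comp_trunc p polyfun.var)
    qed
    moreover have "(\<exists>y\<in>coords M. y \<in> lexmin (B t) M \<and> u = p y) \<longleftrightarrow> u = p (x t)" for t u
      using lexmin_unique[OF sub xL] xL xB sub by (metis subsetD)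
    ultimately show ?thesis by (simp add: dfun_def)
  qed
  then show ?thesis using that xB by blast
qed

lemma dfun_family_eventually_monotone:
  assumes "finite I" "\<And>i. i \<in> I \<Longrightarrow> dfun (h i)"
  shows "\<exists>r>0. \<forall>i\<in>I. (\<forall>t\<in>{0<..<r}. isCont (h i) t) \<and> (mono_on {0<..<r} (h i) \<or> mono_on {0<..<r} (\<lambda>t. - h i t))"
  using assms
proof (induction I rule: finite_induct)
  case empty
  show ?case by (intro exI[of _ 1]) simp
next
  case (insert j I)
  obtain r where r: "r > 0" "\<forall>i\<in>I. (\<forall>t\<in>{0<..<r}. isCont (h i) t) \<and> (mono_on {0<..<r} (h i) \<or> mono_on {0<..<r} (\<lambda>t. - h i t))"
    using insert.IH insert.prems by auto
  obtain s where s: "s > 0" "(\<forall>t\<in>{0<..<s}. isCont (h j) t) \<and> (mono_on {0<..<s} (h j) \<or> mono_on {0<..<s} (\<lambda>t. - h j t))"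
    using dfun_eventually_monotone[of "h j"] insert.prems by auto
  have m: "mono_on {0<..<min r s} f" if "mono_on {0<..<r} f \<or> mono_on {0<..<s} f" for f :: "real \<Rightarrow> real"
    using that by (auto elim: mono_on_subset)
  show ?case
  proof (intro exI[of _ "min r s"] conjI ballI)
    fix i assume "i \<in> insert j I"
    then show "mono_on {0<..<min r s} (h i) \<or> mono_on {0<..<min r s} (\<lambda>t. - h i t)"
      using r s m by blast
  qed (use r s in auto)
qed

section \<open>The talweg curve and its length\<close>

definition l1dist :: "nat \<Rightarrow> (nat \<Rightarrow> real) \<Rightarrow> (nat \<Rightarrow> real) \<Rightarrow> real" where
  "l1dist M x y = (\<Sum>k<M. \<bar>x k - y k\<bar>)"

text \<open>Kurdyka's talweg argument. A definable curve picks on each level of \<^term>\<open>f\<close> a point where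
  the slope \<^term>\<open>sqrt (g x)\<close> is least; its coordinates are eventually monotone, so its length is the
  increment of a bounded monotone function \<^term>\<open>\<psi>\<close>, which serves as desingularising function.\<close>

theorem talweg_inequality:
  fixes A L c :: real
  assumes K: "K \<subseteq> coords M" "compact K" "SA (\<lambda>e. trunc M e \<in> K)"
    and f: "polyfun f" and g: "polyfun g" and g0: "\<And>x. x \<in> K \<Longrightarrow> 0 \<le> g x"
    and AL: "0 \<le> A" "0 \<le> L"
    and first_order: "\<And>x y. x \<in> K \<Longrightarrow> y \<in> K \<Longrightarrow>
      f x - f y \<le> A * sqrt (g x) * l1dist M x y + L * (l1dist M x y)\<^sup>2"
    and freq: "\<And>\<epsilon>. \<epsilon> > 0 \<Longrightarrow> \<exists>x\<in>K. c < f x \<and> f x < c + \<epsilon>"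
  shows "\<exists>\<rho>>0. \<exists>\<psi> W. (\<forall>t\<in>{0<..<\<rho>}. \<bar>\<psi> t\<bar> \<le> W) \<and> (\<forall>x\<in>K. \<forall>s t. 0 < s \<longrightarrow> s \<le> t \<longrightarrow> t < \<rho> \<longrightarrow> f x = c + t \<longrightarrow>
      t - s \<le> sqrt (g x) * (\<psi> t - \<psi> s))"
proof -
  \<comment> \<open>The hypothesis \<open>freq\<close> provides levels arbitrarily close above
    \<open>c\<close>; by tameness all levels close enough above \<open>c\<close> are then attained
    on \<open>K\<close>.\<close>
  have "SA (\<lambda>e. \<exists>x\<in>coords M. x \<in> K \<and> f x = c + e 0)"
    by (rule SA_ex_coords, rule SA_conj, rule K(3))
      (intro SA_eq polyfun_intros polyfun_comp_trunc f)
  from SA_tame[OF this] have "eventually (\<lambda>t. \<exists>x\<in>coords M. x \<in> K \<and> f x = c + t) (at_right 0)"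
  proof
    assume "eventually (\<lambda>t. \<not> (\<exists>x\<in>coords M. x \<in> K \<and> f x = c + t)) (at_right 0)"
    then obtain b where b: "b > 0" "\<And>t. 0 < t \<Longrightarrow> t < b \<Longrightarrow> \<not> (\<exists>x\<in>coords M. x \<in> K \<and> f x = c + t)"
      unfolding eventually_at_right_field by blast
    obtain x where x: "x \<in> K" "c < f x" "f x < c + b" using freq[OF b(1)] by blast
    then show ?thesis using b(2)[of "f x - c"] K(1) by auto
  qed
  then obtain r0 where r0: "r0 > 0" "\<And>t. 0 < t \<Longrightarrow> t < r0 \<Longrightarrow> \<exists>x\<in>K. f x = c + t"
    unfolding eventually_at_right_field by blast
  \<comment> \<open>Outside the interval the default is all of \<open>K\<close>, so that every
    \<open>B t\<close> is compact and nonempty, as \<open>definable_choice\<close> demands.\<close>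
  define B where "B t = {x \<in> K. 0 < t \<and> t < r0 \<longrightarrow> f x = c + t}" for t
  have dB: "dfam M B"
    unfolding dfam_def
  proof
    show "\<forall>t. B t \<subseteq> coords M" using K(1) by (auto simp: B_def)
    have "SA (\<lambda>e. trunc M e \<in> K \<and> (0 < e M \<and> e M < r0 \<longrightarrow> f (trunc M e) = c + e M))"
      by (intro SA_conj SA_imp K(3) SA_less SA_eq polyfun_intros polyfun_comp_trunc f)
    then show "SA (\<lambda>e. trunc M e \<in> B (e M))" by (simp add: B_def)
  qed
  have Bne: "B t \<noteq> {}" for t
    using r0(2)[of t] r0(2)[of "r0 / 2"] r0(1) by (auto simp: B_def)
  have Bc: "compact (B t)" for t
  proof (cases "0 < t \<and> t < r0")
    case True
    then have "B t = K \<inter> {x. f x = c + t}" by (auto simp: B_def)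
    moreover have "closed {x. f x = c + t}"
      by (intro closed_Collect_eq continuous_on_polyfun f continuous_on_const)
    ultimately show ?thesis using K(2) by (simp add: compact_Int_closed)
  next
    case False
    then have "B t = K" by (auto simp: B_def)
    then show ?thesis using K(2) by simp
  qed
  obtain x where x: "\<And>t. x t \<in> argmin_on g (B t)" and dx: "\<And>p. polyfun p \<Longrightarrow> dfun (\<lambda>t. p (x t))"
    using definable_choice[OF dfam_argmin[OF dB g] compact_argmin_on(1)[OF Bc Bne g] compact_argmin_on(2)[OF Bc Bne g]]
    by blast
  have xK: "x t \<in> K" for t using x[of t] by (auto simp: argmin_on_def B_def)
  have fx: "f (x t) = c + t" if "0 < t" "t < r0" for t
    using x[of t] that by (auto simp: argmin_on_def B_def)
  have gx: "g (x t) \<le> g y" if "0 < t" "t < r0" "y \<in> K" "f y = c + t" for t y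
    using x[of t] that by (auto simp: argmin_on_def B_def)
  \<comment> \<open>Index \<open>M\<close> holds the squared slope along the curve, so a single
    radius serves the coordinates and the slope.\<close>
  define h where "h i t = (if i < M then x t i else g (x t))" for i t
  have "dfun (h i)" for i
    using dx[OF polyfun.var[of i]] dx[OF g] by (cases "i < M") (simp_all add: h_def[abs_def])
  then obtain r1 where r1: "r1 > 0" "\<And>i. i \<le> M \<Longrightarrow> (\<forall>t\<in>{0<..<r1}. isCont (h i) t) \<and>
      (mono_on {0<..<r1} (h i) \<or> mono_on {0<..<r1} (\<lambda>t. - h i t))"
    using dfun_family_eventually_monotone[of "{..M}" h] by auto
  define r where "r = min r0 r1"
  have r: "r > 0" "r \<le> r0" "r \<le> r1" using r0 r1 by (auto simp: r_def)
  have "\<exists>\<sigma>::real. \<bar>\<sigma>\<bar> = 1 \<and> (\<forall>s t. 0 < s \<longrightarrow> s \<le> t \<longrightarrow> t < r \<longrightarrow> \<bar>x t i - x s i\<bar> = \<sigma> * (x t i - x s i))" if i: "i < M" for i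
    using r1(2)[OF less_imp_le[OF i]]
  proof (elim conjE disjE)
    assume m: "mono_on {0<..<r1} (h i)"
    have "x s i \<le> x t i" if "0 < s" "s \<le> t" "t < r" for s t
      using mono_onD[OF m, of s t] that i r by (auto simp: h_def)
    then show ?thesis by (intro exI[of _ 1]) auto
  next
    assume m: "mono_on {0<..<r1} (\<lambda>t. - h i t)"
    have "x t i \<le> x s i" if "0 < s" "s \<le> t" "t < r" for s t
      using mono_onD[OF m, of s t] that i r by (auto simp: h_def)
    then show ?thesis by (intro exI[of _ "- 1"]) auto
  qed
  then obtain \<sigma> :: "nat \<Rightarrow> real" where \<sigma>: "\<And>i. i < M \<Longrightarrow> \<bar>\<sigma> i\<bar> = 1"
    "\<And>i s t. i < M \<Longrightarrow> 0 < s \<Longrightarrow> s \<le> t \<Longrightarrow> t < r \<Longrightarrow> \<bar>x t i - x s i\<bar> = \<sigma> i * (x t i - x s i)"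
    by metis
  \<comment> \<open>\<sigma> records the direction in which each coordinate moves; with these signs
    the l1 distance between two points of the curve is exactly an increment of \<psi>.\<close>
  define \<psi> where "\<psi> t = (\<Sum>i<M. \<sigma> i * x t i)" for t
  have dist: "l1dist M (x t) (x s) = \<psi> t - \<psi> s" if "0 < s" "s \<le> t" "t < r" for s t
    using \<sigma>(2)[OF _ that] by (simp add: l1dist_def \<psi>_def sum_subtractf[symmetric] right_diff_distrib)
  have \<psi>mono: "\<psi> s \<le> \<psi> t" if "0 < s" "s \<le> t" "t < r" for s t
    using dist[OF that] sum_nonneg[of "{..<M}" "\<lambda>k. \<bar>x t k - x s k\<bar>"] by (simp add: l1dist_def)
  have contx: "isCont (\<lambda>t. x t i) t" if "i < M" "0 < t" "t < r" for i t
  proof -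
    have "isCont (h i) t" using r1(2)[of i] that r by auto
    moreover have "h i = (\<lambda>t. x t i)" using that by (simp add: h_def fun_eq_iff)
    ultimately show ?thesis by simp
  qed
  have \<psi>cont: "isCont \<psi> t" if "0 < t" "t < r" for t
    unfolding \<psi>_def using that contx by (intro continuous_intros) auto
  have "\<exists>W. \<forall>y\<in>K. (\<Sum>k<M. \<bar>y k\<bar>) \<le> W"
  proof -
    have "continuous_on K (\<lambda>y. \<Sum>k<M. \<bar>y k\<bar>)"
      by (intro continuous_intros continuous_on_polyfun polyfun.var)
    then have "compact ((\<lambda>y. \<Sum>k<M. \<bar>y k\<bar>) ` K)"
      using K(2) by (rule compact_continuous_image)
    then have "bdd_above ((\<lambda>y. \<Sum>k<M. \<bar>y k\<bar>) ` K)"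
      by (intro bounded_imp_bdd_above compact_imp_bounded)
    then show ?thesis by (auto simp: bdd_above_def)
  qed
  then obtain W where W: "\<And>y. y \<in> K \<Longrightarrow> (\<Sum>k<M. \<bar>y k\<bar>) \<le> W" by blast
  have \<psi>bd: "\<bar>\<psi> t\<bar> \<le> W" for t
  proof -
    have "\<bar>\<psi> t\<bar> \<le> (\<Sum>i<M. \<bar>\<sigma> i * x t i\<bar>)" unfolding \<psi>_def by (rule sum_abs)
    also have "\<dots> = (\<Sum>i<M. \<bar>x t i\<bar>)" using \<sigma>(1) by (simp add: abs_mult)
    also have "\<dots> \<le> W" using W xK by blast
    finally show ?thesis .
  qed
  \<comment> \<open>\<open>first_order\<close> has a quadratic error. On short pieces of the curve
    it is at most an arbitrarily small multiple of the length, and the pieces add up since both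
    sides are increments.\<close>
  have length: "t - s \<le> A * \<mu> * (\<psi> t - \<psi> s)"
    if st: "0 < s" "s \<le> t" "t < r" and \<mu>: "0 \<le> \<mu>" "\<And>v. s \<le> v \<Longrightarrow> v \<le> t \<Longrightarrow> sqrt (g (x v)) \<le> \<mu>" for s t \<mu>
  proof -
    have approx: "t - s \<le> (A * \<mu> + \<eta>) * (\<psi> t - \<psi> s)" if \<eta>: "\<eta> > 0" for \<eta>
    proof -
      have "s \<le> s \<and> t \<le> t \<longrightarrow> t - s \<le> (A * \<mu> + \<eta>) * (\<psi> t - \<psi> s)"
        using \<open>s \<le> t\<close>
      proof (induction rule: Bolzano[where P = "\<lambda>u v. s \<le> u \<and> v \<le> t \<longrightarrow> v - u \<le> (A * \<mu> + \<eta>) * (\<psi> v - \<psi> u)"])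
        case (trans a b c)
        show ?case
        proof
          assume "s \<le> a \<and> c \<le> t"
          then have "b - a \<le> (A * \<mu> + \<eta>) * (\<psi> b - \<psi> a)" "c - b \<le> (A * \<mu> + \<eta>) * (\<psi> c - \<psi> b)"
            using trans by auto
          then show "c - a \<le> (A * \<mu> + \<eta>) * (\<psi> c - \<psi> a)"
            by (simp add: right_diff_distrib)
        qed
      next
        case (local z)
        \<comment> \<open>Within \<open>\<kappa>\<close> of \<open>\<psi> z\<close> at both ends the
          length \<open>N\<close> is at most \<open>2 * \<kappa>\<close>, whence
          \<open>L * N \<le> \<eta>\<close>.\<close>
        define \<kappa> where "\<kappa> = \<eta> / (2 * (L + 1))"
        have \<kappa>: "\<kappa> > 0" using \<eta> AL by (simp add: \<kappa>_def)
        have "isCont \<psi> z" by (rule \<psi>cont) (use local st in linarith)+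
        from this[unfolded continuous_at_real_range real_norm_def, rule_format, OF \<kappa>]
        obtain d where d: "d > 0" "\<And>w. \<bar>w - z\<bar> < d \<Longrightarrow> \<bar>\<psi> w - \<psi> z\<bar> < \<kappa>"
          by blast
        show ?case
        proof (intro exI[of _ d] conjI allI impI)
          fix u v assume uv: "u \<le> z \<and> z \<le> v \<and> v - u < d" and in_st: "s \<le> u \<and> v \<le> t"
          define N where "N = l1dist M (x v) (x u)"
          have N: "N = \<psi> v - \<psi> u"
            unfolding N_def by (rule dist) (use uv in_st st in linarith)+
          have "\<bar>\<psi> v - \<psi> z\<bar> < \<kappa>" "\<bar>\<psi> u - \<psi> z\<bar> < \<kappa>" using d(2)[of v] d(2)[of u] uv by simp_all
          then have "N \<le> 2 * \<kappa>" using N by linarith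
          have N0: "N \<ge> 0" by (simp add: N_def l1dist_def sum_nonneg)
          have "L * N \<le> (L + 1) * (2 * \<kappa>)"
            by (rule mult_mono) (use AL N0 \<open>N \<le> 2 * \<kappa>\<close> in simp_all)
          also have "\<dots> = \<eta>" using AL unfolding \<kappa>_def by (simp add: nonzero_divide_eq_eq nonzero_eq_divide_eq field_simps)
          finally have LN: "L * N \<le> \<eta>" .
          have "f (x u) = c + u" by (rule fx) (use uv in_st st r in linarith)+
          moreover have "f (x v) = c + v" by (rule fx) (use uv in_st st r in linarith)+
          ultimately have "v - u = f (x v) - f (x u)" by simp
          also have "\<dots> \<le> A * sqrt (g (x v)) * N + L * N\<^sup>2"
            unfolding N_def by (rule first_order[OF xK xK])
          also have "\<dots> \<le> A * \<mu> * N + \<eta> * N"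
          proof (rule add_mono)
            show "A * sqrt (g (x v)) * N \<le> A * \<mu> * N"
              by (intro mult_right_mono mult_left_mono \<mu>(2) N0 AL) (use uv in_st in linarith)+
            show "L * N\<^sup>2 \<le> \<eta> * N"
              using mult_right_mono[OF LN N0] by (simp add: power2_eq_square)
          qed
          finally show "v - u \<le> (A * \<mu> + \<eta>) * (\<psi> v - \<psi> u)"
            by (simp add: N distrib_right)
        qed (fact d(1))
      qed
      then show ?thesis by simp
    qed
    define D where "D = \<psi> t - \<psi> s"
    have D: "D \<ge> 0" using \<psi>mono[OF st] by (simp add: D_def)
    show ?thesis
    proof (rule field_le_epsilon)
      fix \<epsilon> :: real assume \<epsilon>: "\<epsilon> > 0"
      have "t - s \<le> (A * \<mu> + \<epsilon> / (D + 1)) * D"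
        using approx[of "\<epsilon> / (D + 1)"] \<epsilon> D by (simp add: D_def)
      also have "\<dots> = A * \<mu> * D + \<epsilon> * (D / (D + 1))"
        by (simp add: distrib_right)
      also have "\<epsilon> * (D / (D + 1)) \<le> \<epsilon> * 1"
        using \<epsilon> D by (intro mult_left_mono) auto
      finally show "t - s \<le> A * \<mu> * (\<psi> t - \<psi> s) + \<epsilon>" by (simp add: D_def)
    qed
  qed
  have sub: "{0<..<r} \<subseteq> {0<..<r1}" using r(3) by auto
  have hM: "h M = (\<lambda>t. g (x t))" by (simp add: h_def fun_eq_iff)
  have "mono_on {0<..<r} (\<lambda>t. g (x t)) \<or> mono_on {0<..<r} (\<lambda>t. - g (x t))"
    using r1(2)[of M] mono_on_subset[OF _ sub, of "\<lambda>t. g (x t)"] mono_on_subset[OF _ sub, of "\<lambda>t. - g (x t)"]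
    unfolding hM by blast
  then show ?thesis
  proof
    \<comment> \<open>On \<open>[s, t]\<close> the slope of the curve is largest at
      \<open>t\<close>, where it is at most the slope at \<open>y\<close> because the curve
      minimises it on the level of \<open>y\<close>.\<close>
    assume gm: "mono_on {0<..<r} (\<lambda>t. g (x t))"
    show ?thesis
    proof (rule exI[of _ r], intro conjI exI[of _ "\<lambda>t. A * \<psi> t"] exI[of _ "A * W"] ballI allI impI)
      fix y s t assume y: "y \<in> K" and st: "0 < s" "s \<le> t" "t < r" "f y = c + t"
      have "t - s \<le> A * sqrt (g y) * (\<psi> t - \<psi> s)"
      proof (rule length[OF st(1-3)])
        fix v assume v: "s \<le> v" "v \<le> t"
        have "g (x v) \<le> g (x t)" using mono_onD[OF gm, of v t] v st by auto
        also have "\<dots> \<le> g y" using gx[of t y] st y r by auto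
        finally show "sqrt (g (x v)) \<le> sqrt (g y)" by simp
      qed (use g0 y in simp)
      then show "t - s \<le> sqrt (g y) * (A * \<psi> t - A * \<psi> s)"
        by (simp add: right_diff_distrib mult.assoc mult.left_commute)
    next
      fix t show "\<bar>A * \<psi> t\<bar> \<le> A * W"
        using \<psi>bd[of t] AL by (simp add: abs_mult mult_left_mono)
    qed (fact r(1))
  next
    \<comment> \<open>Now the slope on levels close above \<open>c\<close> is bounded below by the
      constant \<open>m\<close>, so the linear function \<open>t / m\<close> desingularises. If
      \<open>m\<close> were 0, the slope would vanish along the curve from \<open>r / 2\<close> on,
      while \<open>f\<close> still increases there, against \<open>length\<close>.\<close>
    assume gm: "mono_on {0<..<r} (\<lambda>t. - g (x t))"
    define m where "m = sqrt (g (x (r / 2)))"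
    have anti: "g (x v) \<le> g (x u)" if "0 < u" "u \<le> v" "v < r" for u v
      using mono_onD[OF gm, of u v] that by auto
    have "m \<noteq> 0"
    proof
      assume "m = 0"
      then have "g (x (r / 2)) = 0" by (simp add: m_def)
      have "3 * r / 4 - r / 2 \<le> A * 0 * (\<psi> (3 * r / 4) - \<psi> (r / 2))"
      proof (rule length)
        fix v assume v: "r / 2 \<le> v" "v \<le> 3 * r / 4"
        then have "g (x v) \<le> g (x (r / 2))" using anti[of "r / 2" v] r(1) by auto
        then show "sqrt (g (x v)) \<le> 0" using \<open>g (x (r / 2)) = 0\<close> by simp
      qed (use r in auto)
      then show False using r(1) by simp
    qed
    moreover have "m \<ge> 0" using g0[OF xK] by (simp add: m_def)
    ultimately have m: "m > 0" by simp
    show ?thesis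
    proof (rule exI[of _ "r / 2"], intro conjI exI[of _ "\<lambda>t. t / m"] exI[of _ "r / m"] ballI allI impI)
      fix y s t assume y: "y \<in> K" and st: "0 < s" "s \<le> t" "t < r / 2" "f y = c + t"
      have "g (x (r / 2)) \<le> g (x t)" using anti[of t "r / 2"] st by auto
      also have "\<dots> \<le> g y" using gx[of t y] st y r by auto
      finally have "m \<le> sqrt (g y)" by (simp add: m_def)
      then have "m * (t / m - s / m) \<le> sqrt (g y) * (t / m - s / m)"
        using m st by (intro mult_right_mono) (auto simp: diff_divide_distrib[symmetric])
      moreover have "m * (t / m - s / m) = t - s" using m by (simp add: right_diff_distrib)
      ultimately show "t - s \<le> sqrt (g y) * (t / m - s / m)" by simp
    next
      fix t assume "t \<in> {0<..<r / 2}"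
      then show "\<bar>t / m\<bar> \<le> r / m" using m by (simp add: divide_right_mono)
    qed (use r in simp)
  qed
qed

section \<open>The objective on the product of spheres\<close>

text \<open>For symmetric \<open>C\<close> this is half the Riemannian gradient of
  \<open>mix_obj\<close>, as the Euclidean gradient is twice \<open>mix_grad\<close>; hence the
  factor 2 in the first-order estimate.\<close>

definition riem_grad :: "(nat \<Rightarrow> nat \<Rightarrow> real) \<Rightarrow> nat \<Rightarrow> (nat \<Rightarrow> real^'k) \<Rightarrow> nat \<Rightarrow> real^'k" where
  "riem_grad C n V i = mix_grad C n V i - (V i \<bullet> mix_grad C n V i) *\<^sub>R V i"

definition abs_cost :: "(nat \<Rightarrow> nat \<Rightarrow> real) \<Rightarrow> nat \<Rightarrow> real" where
  "abs_cost C n = (\<Sum>i<n. \<Sum>j<n. \<bar>C i j\<bar>)"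

lemma abs_cost_nonneg: "0 \<le> abs_cost C n"
  by (simp add: abs_cost_def sum_nonneg)

lemma row_le_abs_cost:
  assumes "i < n"
  shows "(\<Sum>j<n. \<bar>C i j\<bar>) \<le> abs_cost C n"
  unfolding abs_cost_def using assms
  by (intro member_le_sum[of i "{..<n}" "\<lambda>i. \<Sum>j<n. \<bar>C i j\<bar>"]) (auto intro: sum_nonneg)

text \<open>Taylor expansion of a quadratic form, which is exact at second order; symmetry merges
  the two mixed terms.\<close>

lemma mix_obj_expand:
  fixes V W :: "nat \<Rightarrow> real^'k"
  assumes symm: "\<forall>i<n. \<forall>j<n. C i j = C j i"
  shows "mix_obj C n W = mix_obj C n V + 2 * (\<Sum>i<n. mix_grad C n V i \<bullet> (W i - V i)) + mix_obj C n (\<lambda>i. W i - V i)"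
proof -
  define D where "D i = W i - V i" for i
  have grad: "(\<Sum>i<n. mix_grad C n V i \<bullet> D i) = (\<Sum>i<n. \<Sum>j<n. C i j * (V j \<bullet> D i))"
    by (simp add: mix_grad_def inner_sum_left)
  have swap: "(\<Sum>i<n. \<Sum>j<n. C i j * (V i \<bullet> D j)) = (\<Sum>i<n. \<Sum>j<n. C i j * (V j \<bullet> D i))"
  proof -
    have "(\<Sum>i<n. \<Sum>j<n. C i j * (V i \<bullet> D j)) = (\<Sum>j<n. \<Sum>i<n. C i j * (V i \<bullet> D j))"
      by (rule sum.swap)
    also have "\<dots> = (\<Sum>j<n. \<Sum>i<n. C j i * (V i \<bullet> D j))"
    proof (intro sum.cong refl)
      fix i j assume "i \<in> {..<n}" "j \<in> {..<n}"
      then have "C i j = C j i" using symm by blast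
      then show "C i j * (V i \<bullet> D j) = C j i * (V i \<bullet> D j)" by (rule arg_cong)
    qed
    finally show ?thesis .
  qed
  have "W i \<bullet> W j = V i \<bullet> V j + V j \<bullet> D i + V i \<bullet> D j + D i \<bullet> D j" for i j
    using inner_commute[of "V i" "V j"] inner_commute[of "W i" "V j"]
    by (simp add: D_def inner_diff_left inner_diff_right)
  then have "mix_obj C n W = (\<Sum>i<n. \<Sum>j<n. C i j * (V i \<bullet> V j) + C i j * (V j \<bullet> D i) + C i j * (V i \<bullet> D j) + C i j * (D i \<bullet> D j))"
    by (simp add: mix_obj_def distrib_left)
  also have "\<dots> = mix_obj C n V + 2 * (\<Sum>i<n. mix_grad C n V i \<bullet> D i) + mix_obj C n D"
    unfolding grad by (simp add: sum.distrib swap mix_obj_def)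
  finally show ?thesis by (simp add: D_def[abs_def])
qed

lemma abs_mix_obj_le:
  assumes "\<And>i. i < n \<Longrightarrow> norm (D i) \<le> u"
  shows "\<bar>mix_obj C n D\<bar> \<le> abs_cost C n * u\<^sup>2"
proof -
  have "\<bar>mix_obj C n D\<bar> \<le> (\<Sum>i<n. \<Sum>j<n. \<bar>C i j * (D i \<bullet> D j)\<bar>)"
    unfolding mix_obj_def by (intro order_trans[OF sum_abs] sum_mono) simp
  also have "\<dots> \<le> (\<Sum>i<n. \<Sum>j<n. \<bar>C i j\<bar> * u\<^sup>2)"
  proof (intro sum_mono)
    fix i j assume ij: "i \<in> {..<n}" "j \<in> {..<n}"
    have "\<bar>D i \<bullet> D j\<bar> \<le> norm (D i) * norm (D j)" by (rule Cauchy_Schwarz_ineq2)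
    also have "\<dots> \<le> u * u"
      using ij assms by (intro mult_mono') auto
    finally show "\<bar>C i j * (D i \<bullet> D j)\<bar> \<le> \<bar>C i j\<bar> * u\<^sup>2"
      by (simp add: abs_mult power2_eq_square mult_left_mono)
  qed
  also have "\<dots> = abs_cost C n * u\<^sup>2"
    by (simp add: abs_cost_def sum_distrib_right)
  finally show ?thesis .
qed

lemma norm_mix_grad_le:
  assumes "i < n" "\<And>j. j < n \<Longrightarrow> norm (V j) \<le> u" "0 \<le> u"
  shows "norm (mix_grad C n V i) \<le> abs_cost C n * u"
proof -
  have "norm (mix_grad C n V i) \<le> (\<Sum>j<n. \<bar>C i j\<bar> * norm (V j))"
    unfolding mix_grad_def by (rule order_trans[OF norm_sum]) simp
  also have "\<dots> \<le> (\<Sum>j<n. \<bar>C i j\<bar> * u)"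
    using assms by (intro sum_mono mult_left_mono) auto
  also have "\<dots> \<le> abs_cost C n * u"
    using row_le_abs_cost[OF assms(1), of C] assms(3) by (simp add: sum_distrib_right[symmetric] mult_right_mono)
  finally show ?thesis .
qed

text \<open>Orthogonal projection realises the least distance from \<open>w\<close> to the line
  through \<open>v\<close>. The freedom in \<open>a\<close> allows a convenient multiple of
  \<open>v\<close> when the Riemannian gradient is estimated.\<close>

lemma norm_tangent_le:
  fixes v w :: "'a::real_inner"
  assumes "norm v = 1"
  shows "norm (w - (v \<bullet> w) *\<^sub>R v) \<le> norm (w + a *\<^sub>R v)"
proof -
  have vv: "v \<bullet> v = 1" using assms by (simp add: norm_eq_1)
  define \<alpha> where "\<alpha> = v \<bullet> w"
  have wv: "w \<bullet> v = \<alpha>" "v \<bullet> w = \<alpha>" by (simp_all add: \<alpha>_def inner_commute)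
  have "(norm (w - \<alpha> *\<^sub>R v))\<^sup>2 = w \<bullet> w - \<alpha>\<^sup>2"
    unfolding power2_norm_eq_inner by (simp add: inner_diff_left inner_diff_right vv wv power2_eq_square)
  also have "\<dots> \<le> w \<bullet> w - \<alpha>\<^sup>2 + (a + \<alpha>)\<^sup>2" by simp
  also have "\<dots> = (norm (w + a *\<^sub>R v))\<^sup>2"
    unfolding power2_norm_eq_inner
    by (simp add: inner_add_left inner_add_right vv wv power2_eq_square algebra_simps)
  finally have "norm (w - \<alpha> *\<^sub>R v) \<le> norm (w + a *\<^sub>R v)"
    by (rule power2_le_imp_le) simp
  then show ?thesis by (simp add: \<alpha>_def)
qed

lemma unit_inner_diff:
  fixes v w :: "'a::real_inner"
  assumes "norm v = 1" "norm w = 1"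
  shows "v \<bullet> (v - w) = (norm (v - w))\<^sup>2 / 2"
  using assms inner_commute[of w v]
  by (simp add: power2_norm_eq_inner inner_diff_left inner_diff_right norm_eq_1)

text \<open>Since \<^term>\<open>v \<bullet> (v - w) = (norm (v - w))\<^sup>2 / 2\<close> for unit vectors, the normal part of the
  gradient only contributes to the quadratic error.\<close>

lemma mix_obj_first_order:
  fixes V W :: "nat \<Rightarrow> real^'k"
  assumes symm: "\<forall>i<n. \<forall>j<n. C i j = C j i"
    and unit: "\<And>i. i < n \<Longrightarrow> norm (V i) = 1" "\<And>i. i < n \<Longrightarrow> norm (W i) = 1"
    and u: "(\<Sum>i<n. norm (V i - W i)) \<le> u"
  shows "mix_obj C n V - mix_obj C n W \<le>
    2 * sqrt (\<Sum>i<n. (norm (riem_grad C n V i))\<^sup>2) * u + 2 * abs_cost C n * u\<^sup>2"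
proof -
  define s where "s = sqrt (\<Sum>i<n. (norm (riem_grad C n V i))\<^sup>2)"
  define U where "U = (\<Sum>i<n. norm (V i - W i))"
  have U0: "0 \<le> U" by (simp add: U_def sum_nonneg)
  have leU: "norm (V i - W i) \<le> U" if "i < n" for i
    unfolding U_def using that by (intro member_le_sum) auto
  have les: "norm (riem_grad C n V i) \<le> s" if "i < n" for i
  proof -
    have "(norm (riem_grad C n V i))\<^sup>2 \<le> (\<Sum>i<n. (norm (riem_grad C n V i))\<^sup>2)"
      using that by (intro member_le_sum) auto
    then show ?thesis unfolding s_def by (rule real_le_rsqrt)
  qed
  have s0: "0 \<le> s" by (simp add: s_def sum_nonneg)
  have first: "mix_grad C n V i \<bullet> (V i - W i) \<le> s * norm (V i - W i) + \<bar>\<Sum>j<n. \<bar>C i j\<bar>\<bar> * U\<^sup>2 / 2" if i: "i < n" for i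
  proof -
    have "mix_grad C n V i \<bullet> (V i - W i) = riem_grad C n V i \<bullet> (V i - W i) + (V i \<bullet> mix_grad C n V i) * ((norm (V i - W i))\<^sup>2 / 2)"
      using unit_inner_diff[OF unit(1)[OF i] unit(2)[OF i]]
      by (simp add: riem_grad_def inner_diff_left)
    also have "riem_grad C n V i \<bullet> (V i - W i) \<le> s * norm (V i - W i)"
      using norm_cauchy_schwarz[of "riem_grad C n V i" "V i - W i"] mult_right_mono[OF les[OF i] norm_ge_zero[of "V i - W i"]]
      by linarith
    also have "(V i \<bullet> mix_grad C n V i) * ((norm (V i - W i))\<^sup>2 / 2) \<le> \<bar>\<Sum>j<n. \<bar>C i j\<bar>\<bar> * (U\<^sup>2 / 2)"
    proof (rule mult_mono)
      have "V i \<bullet> mix_grad C n V i \<le> norm (mix_grad C n V i)"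
        using norm_cauchy_schwarz[of "V i" "mix_grad C n V i"] unit(1)[OF i] by simp
      also have "\<dots> \<le> (\<Sum>j<n. \<bar>C i j\<bar>)"
        unfolding mix_grad_def by (rule order_trans[OF norm_sum]) (use unit in simp)
      finally show "V i \<bullet> mix_grad C n V i \<le> \<bar>\<Sum>j<n. \<bar>C i j\<bar>\<bar>" by simp
      show "(norm (V i - W i))\<^sup>2 / 2 \<le> U\<^sup>2 / 2"
        using leU[OF i] by (simp add: power_mono)
    qed auto
    finally show ?thesis by simp
  qed
  have "mix_obj C n V - mix_obj C n W = 2 * (\<Sum>i<n. mix_grad C n V i \<bullet> (V i - W i)) - mix_obj C n (\<lambda>i. W i - V i)"
    using mix_obj_expand[OF symm, of W V] by (simp add: inner_diff_right sum_subtractf)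
  \<comment> \<open>After doubling, the normal parts contribute
    \<open>abs_cost C n * U\<^sup>2\<close>; the quadratic remainder contributes as much
    again.\<close>
  also have "\<dots> \<le> 2 * (s * U + abs_cost C n * (U\<^sup>2 / 2)) + abs_cost C n * U\<^sup>2"
  proof -
    have "(\<Sum>i<n. mix_grad C n V i \<bullet> (V i - W i)) \<le> (\<Sum>i<n. s * norm (V i - W i) + \<bar>\<Sum>j<n. \<bar>C i j\<bar>\<bar> * U\<^sup>2 / 2)"
      by (intro sum_mono first) simp
    also have "\<dots> = (\<Sum>i<n. s * norm (V i - W i)) + (\<Sum>i<n. (\<Sum>j<n. \<bar>C i j\<bar>) * (U\<^sup>2 / 2))"
      by (simp add: sum.distrib sum_nonneg)
    also have "\<dots> = s * U + abs_cost C n * (U\<^sup>2 / 2)"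
      by (simp only: U_def abs_cost_def sum_distrib_left[symmetric] sum_distrib_right[symmetric])
    finally have 1: "(\<Sum>i<n. mix_grad C n V i \<bullet> (V i - W i)) \<le> s * U + abs_cost C n * (U\<^sup>2 / 2)" .
    have "\<bar>mix_obj C n (\<lambda>i. W i - V i)\<bar> \<le> abs_cost C n * U\<^sup>2"
      by (rule abs_mix_obj_le) (use leU in \<open>simp add: norm_minus_commute\<close>)
    then have "- mix_obj C n (\<lambda>i. W i - V i) \<le> abs_cost C n * U\<^sup>2" by (rule abs_le_D2)
    then show ?thesis using mult_left_mono[OF 1, of 2] by simp
  qed
  also have "\<dots> = 2 * s * U + 2 * abs_cost C n * U\<^sup>2" by (simp add: algebra_simps)
  also have "\<dots> \<le> 2 * s * u + 2 * abs_cost C n * u\<^sup>2"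
    using u U0 s0 abs_cost_nonneg[of C n] unfolding U_def[symmetric]
    by (intro add_mono mult_left_mono power_mono) auto
  finally show ?thesis by (simp add: s_def)
qed

text \<open>Tychonoff's theorem, with the factor {0} from index \<open>M\<close> on.\<close>

lemma compact_box_coords: "compact {x \<in> coords M. \<forall>k<M. \<bar>x k\<bar> \<le> 1}"
proof -
  define S where "S k = (if k < M then {-1..1} else {0::real})" for k :: nat
  have "compactin (product_topology (\<lambda>i. euclidean) UNIV) (PiE UNIV S)"
    unfolding compactin_PiE by (auto simp: S_def)
  then have "compact (PiE UNIV S)"
    by (simp add: euclidean_product_topology)
  moreover have "PiE UNIV S = {x \<in> coords M. \<forall>k<M. \<bar>x k\<bar> \<le> 1}"
    by (auto simp: S_def coords_def PiE_iff abs_le_iff split: if_splits)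
  ultimately show ?thesis by simp
qed

text \<open>The columns are flattened into one vector of \<open>n * CARD('k)\<close> real coordinates.\<close>

theorem mix_obj_desingularisation:
  fixes c :: real and C :: "nat \<Rightarrow> nat \<Rightarrow> real"
  assumes symm: "\<forall>i<n. \<forall>j<n. C i j = C j i"
    and freq: "\<And>\<epsilon>. \<epsilon> > 0 \<Longrightarrow> \<exists>V :: nat \<Rightarrow> real^'k. (\<forall>i<n. norm (V i) = 1) \<and> c < mix_obj C n V \<and> mix_obj C n V < c + \<epsilon>"
  shows "\<exists>\<rho>>0. \<exists>\<psi> B. (\<forall>t\<in>{0<..<\<rho>}. \<bar>\<psi> t\<bar> \<le> B) \<and>
    (\<forall>(V :: nat \<Rightarrow> real^'k) s t. (\<forall>i<n. norm (V i) = 1) \<longrightarrow> 0 < s \<longrightarrow> s \<le> t \<longrightarrow> t < \<rho> \<longrightarrow> mix_obj C n V = c + t \<longrightarrow>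
      t - s \<le> sqrt (\<Sum>i<n. (norm (riem_grad C n V i))\<^sup>2) * (\<psi> t - \<psi> s))"
proof -
  define I where "I = {..<n} \<times> (UNIV :: 'k set)"
  define M where "M = card I"
  have "finite I" by (simp add: I_def)
  then obtain \<iota> where \<iota>: "bij_betw \<iota> {..<M} I"
    using ex_bij_betw_nat_finite[of I] unfolding M_def atLeast0LessThan by blast
  define \<kappa> where "\<kappa> = inv_into {..<M} \<iota>"
  have \<kappa>: "\<kappa> (i, a) < M" "\<iota> (\<kappa> (i, a)) = (i, a)" if "i < n" for i a
  proof -
    have "(i, a) \<in> \<iota> ` {..<M}" using \<iota> that by (auto simp: bij_betw_def I_def)
    then show "\<kappa> (i, a) < M" "\<iota> (\<kappa> (i, a)) = (i, a)"
      unfolding \<kappa>_def using inv_into_into[of "(i, a)" \<iota> "{..<M}"] f_inv_into_f[of "(i, a)" \<iota> "{..<M}"] by auto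
  qed
  have \<kappa>_bij: "bij_betw \<kappa> I {..<M}"
    unfolding \<kappa>_def by (rule bij_betw_inv_into[OF \<iota>])
  define dec :: "(nat \<Rightarrow> real) \<Rightarrow> nat \<Rightarrow> real^'k" where "dec x i = (\<chi> a. x (\<kappa> (i, a)))" for x i
  define enc :: "(nat \<Rightarrow> real^'k) \<Rightarrow> nat \<Rightarrow> real" where
    "enc V = (\<lambda>k. if k < M then V (fst (\<iota> k)) $ snd (\<iota> k) else 0)" for V
  have enc_coords: "enc V \<in> coords M" for V by (simp add: enc_def coords_def)
  have dec_enc: "dec (enc V) i = V i" if "i < n" for V i
    using \<kappa>[OF that] by (simp add: dec_def enc_def vec_eq_iff)
  \<comment> \<open>Decoding an encoded family restores only the columns below \<open>n\<close>, so
    objective and gradient must be seen to depend on those alone.\<close>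
  have obj_cong: "mix_obj C n V = mix_obj C n V'" if "\<And>i. i < n \<Longrightarrow> V i = V' i" for V V' :: "nat \<Rightarrow> real^'k"
    using that by (simp add: mix_obj_def)
  have grad_cong: "riem_grad C n V i = riem_grad C n V' i" if "\<And>i. i < n \<Longrightarrow> V i = V' i" "i < n" for V V' :: "nat \<Rightarrow> real^'k" and i
    using that by (simp add: riem_grad_def mix_grad_def)
  have dec_poly: "polyfun (\<lambda>x. dec x i $ a)" for i a
    by (simp add: dec_def polyfun.var)
  have inner_poly: "polyfun (\<lambda>x. V x \<bullet> W x)" if "\<And>a. polyfun (\<lambda>x. V x $ a)" "\<And>a. polyfun (\<lambda>x. W x $ a)"
    for V W :: "(nat \<Rightarrow> real) \<Rightarrow> real^'k"
    unfolding inner_vec_def inner_real_def using that by (intro polyfun_intros) auto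
  define f where "f x = mix_obj C n (dec x)" for x
  define g where "g x = (\<Sum>i<n. (norm (riem_grad C n (dec x) i))\<^sup>2)" for x
  \<comment> \<open>Unit length is written with inner products, which makes the condition polynomial
    in the coordinates.\<close>
  define K where "K = {x \<in> coords M. \<forall>i\<in>{..<n}. dec x i \<bullet> dec x i = 1}"
  have f_poly: "polyfun f"
    unfolding f_def mix_obj_def by (intro polyfun_intros inner_poly dec_poly)
  have mg_poly: "polyfun (\<lambda>x. mix_grad C n (dec x) i $ a)" for i a
    unfolding mix_grad_def sum_component vector_scaleR_component real_scaleR_def by (intro polyfun_intros dec_poly)
  have rg_poly: "polyfun (\<lambda>x. riem_grad C n (dec x) i $ a)" for i a
    unfolding riem_grad_def vector_minus_component vector_scaleR_component real_scaleR_def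
    by (intro polyfun_intros inner_poly dec_poly mg_poly)
  have g_poly: "polyfun g"
    unfolding g_def power2_norm_eq_inner by (intro polyfun_intros inner_poly rg_poly)
  have K_unit: "norm (dec x i) = 1" if "x \<in> K" "i < n" for x i
    using that by (simp add: K_def norm_eq_1)
  have K_compact: "compact K"
  proof -
    have bound: "\<bar>x k\<bar> \<le> 1" if x: "x \<in> K" and k: "k < M" for x k
    proof -
      define i where "i = fst (\<iota> k)"
      define a where "a = snd (\<iota> k)"
      have "\<iota> k \<in> I" using bij_betwE[OF \<iota>] k by simp
      then have i: "i < n" by (simp add: I_def i_def mem_Times_iff)
      have "\<kappa> (i, a) = k"
        using bij_betw_imp_inj_on[OF \<iota>] k by (simp add: \<kappa>_def i_def a_def inv_into_f_f)
      then have "x k = dec x i $ a" by (simp add: dec_def)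
      then show ?thesis
        using component_le_norm_cart[of "dec x i" a] K_unit[OF x i] by simp
    qed
    have "K = {x \<in> coords M. \<forall>k<M. \<bar>x k\<bar> \<le> 1} \<inter> (\<Inter>i\<in>{..<n}. {x. dec x i \<bullet> dec x i = 1})"
    proof
      show "K \<subseteq> {x \<in> coords M. \<forall>k<M. \<bar>x k\<bar> \<le> 1} \<inter> (\<Inter>i\<in>{..<n}. {x. dec x i \<bullet> dec x i = 1})"
      proof
        fix x assume "x \<in> K"
        then show "x \<in> {x \<in> coords M. \<forall>k<M. \<bar>x k\<bar> \<le> 1} \<inter> (\<Inter>i\<in>{..<n}. {x. dec x i \<bullet> dec x i = 1})"
          using bound[of x] unfolding K_def by simp
      qed
    qed (simp add: K_def subset_iff)
    moreover have "closed {x. dec x i \<bullet> dec x i = 1}" for i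
      by (rule closed_Collect_eq[OF continuous_on_polyfun continuous_on_const]) (intro inner_poly dec_poly)
    then have "closed (\<Inter>i\<in>{..<n}. {x. dec x i \<bullet> dec x i = 1})"
      by (intro closed_INT) simp
    ultimately show ?thesis
      using compact_Int_closed[OF compact_box_coords[of M]] by simp
  qed
  have K_SA: "SA (\<lambda>e. trunc M e \<in> K)"
  proof -
    have "polyfun (\<lambda>e. dec (trunc M e) i \<bullet> dec (trunc M e) i)" for i
      by (rule polyfun_comp_trunc[of "\<lambda>x. dec x i \<bullet> dec x i" "\<lambda>e. e"]) (intro inner_poly dec_poly polyfun.var)+
    then have "SA (\<lambda>e. \<forall>i\<in>{..<n}. dec (trunc M e) i \<bullet> dec (trunc M e) i = 1)"
      by (intro SA_all_finite SA_eq polyfun.const) auto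
    then show ?thesis by (simp add: K_def)
  qed
  have l1: "(\<Sum>i<n. norm (dec x i - dec y i)) \<le> l1dist M x y" for x y
  proof -
    have "(\<Sum>i<n. norm (dec x i - dec y i)) \<le> (\<Sum>i<n. \<Sum>a\<in>UNIV. \<bar>x (\<kappa> (i, a)) - y (\<kappa> (i, a))\<bar>)"
    proof (rule sum_mono)
      fix i show "norm (dec x i - dec y i) \<le> (\<Sum>a\<in>UNIV. \<bar>x (\<kappa> (i, a)) - y (\<kappa> (i, a))\<bar>)"
        using norm_le_l1_cart[of "dec x i - dec y i"] by (simp add: dec_def)
    qed
    also have "\<dots> = (\<Sum>p\<in>I. \<bar>x (\<kappa> p) - y (\<kappa> p)\<bar>)"
      unfolding I_def by (simp add: sum.cartesian_product)
    also have "\<dots> = l1dist M x y"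
      unfolding l1dist_def by (rule sum.reindex_bij_betw[OF \<kappa>_bij])
    finally show ?thesis .
  qed
  have "\<exists>\<rho>>0. \<exists>\<psi> B. (\<forall>t\<in>{0<..<\<rho>}. \<bar>\<psi> t\<bar> \<le> B) \<and> (\<forall>x\<in>K. \<forall>s t. 0 < s \<longrightarrow> s \<le> t \<longrightarrow> t < \<rho> \<longrightarrow> f x = c + t \<longrightarrow>
      t - s \<le> sqrt (g x) * (\<psi> t - \<psi> s))"
  \<comment> \<open>The constants are those of \<open>mix_obj_first_order\<close>, whose sum of
    column norms is at most the l1 distance of the coordinates.\<close>
  proof (rule talweg_inequality[where A = 2 and L = "2 * abs_cost C n"])
    show "K \<subseteq> coords M" by (auto simp: K_def)
    show "f x - f y \<le> 2 * sqrt (g x) * l1dist M x y + 2 * abs_cost C n * (l1dist M x y)\<^sup>2"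
      if "x \<in> K" "y \<in> K" for x y
      unfolding f_def g_def using that K_unit l1 by (intro mix_obj_first_order symm) auto
    show "\<exists>x\<in>K. c < f x \<and> f x < c + \<epsilon>" if \<epsilon>: "\<epsilon> > 0" for \<epsilon>
    proof -
      obtain V :: "nat \<Rightarrow> real^'k" where V: "\<forall>i<n. norm (V i) = 1" "c < mix_obj C n V" "mix_obj C n V < c + \<epsilon>"
        using freq[OF \<epsilon>] by blast
      have "f (enc V) = mix_obj C n V" unfolding f_def by (rule obj_cong) (rule dec_enc)
      moreover have "enc V \<in> K" using V(1) enc_coords dec_enc by (simp add: K_def norm_eq_1)
      ultimately show ?thesis using V(2,3) by (intro bexI[of _ "enc V"]) simp_all
    qed
    show "0 \<le> g x" for x by (simp add: g_def sum_nonneg)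
  qed (use K_compact K_SA f_poly g_poly abs_cost_nonneg in auto)
  then obtain \<rho> \<psi> B where \<rho>: "\<rho> > 0" "\<forall>t\<in>{0<..<\<rho>}. \<bar>\<psi> t\<bar> \<le> B"
    and ineq: "\<And>x s t. x \<in> K \<Longrightarrow> 0 < s \<Longrightarrow> s \<le> t \<Longrightarrow> t < \<rho> \<Longrightarrow> f x = c + t \<Longrightarrow> t - s \<le> sqrt (g x) * (\<psi> t - \<psi> s)"
    by blast
  have "t - s \<le> sqrt (\<Sum>i<n. (norm (riem_grad C n V i))\<^sup>2) * (\<psi> t - \<psi> s)"
    if V: "\<forall>i<n. norm (V i) = 1" "mix_obj C n V = c + t" and st: "0 < s" "s \<le> t" "t < \<rho>"
    for V :: "nat \<Rightarrow> real^'k" and s t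
  proof -
    have "f (enc V) = c + t" unfolding f_def V(2)[symmetric] by (rule obj_cong) (rule dec_enc)
    moreover have "enc V \<in> K" using V(1) enc_coords dec_enc by (simp add: K_def norm_eq_1)
    moreover have "g (enc V) = (\<Sum>i<n. (norm (riem_grad C n V i))\<^sup>2)"
      unfolding g_def using grad_cong[of "dec (enc V)" V] dec_enc by simp
    ultimately show ?thesis using ineq[of "enc V" s t] st by simp
  qed
  then show ?thesis using \<rho> by blast
qed

section \<open>The Mixing method\<close>

lemma mix_partial_0: "mix_partial C n V0 r 0 = mix_iter C n V0 r"
  by (simp add: mix_partial_def)

lemma mix_partial_Suc: "mix_partial C n V0 r (Suc i) = mix_update C n (mix_partial C n V0 r i) i"
  by (simp add: mix_partial_def)

lemma mix_partial_n: "mix_partial C n V0 r n = mix_iter C n V0 (Suc r)"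
  by (simp add: mix_partial_def mix_iter_def mix_sweep_def)

lemma mix_partial_ge: "i \<le> j \<Longrightarrow> mix_partial C n V0 r i j = mix_iter C n V0 r j"
  by (induction i) (simp_all add: mix_partial_0 mix_partial_Suc mix_update_def)

lemma mix_partial_fixed: "j < i \<Longrightarrow> i \<le> i' \<Longrightarrow> mix_partial C n V0 r i' j = mix_partial C n V0 r i j"
proof (induction i')
  case (Suc i')
  then show ?case
    by (cases "i = Suc i'") (simp_all add: mix_partial_Suc mix_update_def)
qed simp

lemma mix_partial_less: "j < i \<Longrightarrow> i \<le> n \<Longrightarrow> mix_partial C n V0 r i j = mix_iter C n V0 (Suc r) j"
  using mix_partial_fixed[of j i n C n V0 r] by (simp add: mix_partial_n)

section \<open>Descent, finite length and convergence of the run\<close>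

locale mixing_run =
  fixes C :: "nat \<Rightarrow> nat \<Rightarrow> real" and n :: nat and V0 :: "nat \<Rightarrow> real^'k" and \<delta> :: real
  assumes symm: "\<forall>i<n. \<forall>j<n. C i j = C j i"
    and diag: "\<forall>i<n. C i i = 0"
    and init: "\<forall>i<n. norm (V0 i) = 1"
    and delta_pos: "\<delta> > 0"
    and nondeg: "\<forall>r i. i < n \<longrightarrow> norm (mix_grad C n (mix_partial C n V0 r i) i) \<ge> \<delta>"
begin

abbreviation "X \<equiv> mix_iter C n V0"

abbreviation "grad r i \<equiv> mix_grad C n (mix_partial C n V0 r i) i"

abbreviation "step r i \<equiv> norm (X (Suc r) i - X r i)"

definition "move r = (\<Sum>i<n. step r i)"

lemma X_Suc:
  assumes "i < n"
  shows "X (Suc r) i = - ((1 / norm (grad r i)) *\<^sub>R grad r i)"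
  using mix_partial_less[of i "Suc i" n C V0 r] assms by (simp add: mix_partial_Suc mix_update_def)

lemma grad_nonzero: "i < n \<Longrightarrow> norm (grad r i) > 0"
  using nondeg delta_pos by (meson less_le_trans)

lemma grad_eq:
  assumes "i < n"
  shows "grad r i = - (norm (grad r i) *\<^sub>R X (Suc r) i)"
  using grad_nonzero[OF assms, of r] by (simp add: X_Suc[OF assms])

lemma X_unit: "i < n \<Longrightarrow> norm (X r i) = 1"
proof (induction r)
  case 0
  then show ?case using init by (simp add: mix_iter_def)
next
  case (Suc r)
  then show ?case using grad_nonzero[of i r] by (simp add: X_Suc)
qed

text \<open>Only column \<open>i\<close> moves, so the quadratic remainder is a multiple of
  \<open>C i i = 0\<close> and the change is linear. The gradient is a negative multiple of the new
  unit column, and \<open>unit_inner_diff\<close> evaluates the inner product.\<close>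

lemma mix_obj_partial_Suc:
  assumes i: "i < n"
  shows "mix_obj C n (mix_partial C n V0 r (Suc i)) =
    mix_obj C n (mix_partial C n V0 r i) - norm (grad r i) * (step r i)\<^sup>2"
proof -
  define W where "W = mix_partial C n V0 r i"
  define W' where "W' = mix_partial C n V0 r (Suc i)"
  define d where "d = X (Suc r) i - X r i"
  have diff: "W' j - W j = (if j = i then d else 0)" for j
    using mix_partial_less[of i "Suc i" n C V0 r] mix_partial_ge[of i i C n V0 r] i
    by (auto simp: W_def W'_def d_def mix_partial_Suc mix_update_def)
  have "mix_obj C n (\<lambda>j. W' j - W j) = (\<Sum>j<n. \<Sum>l<n. 0)"
    unfolding mix_obj_def diff using diag i by (intro sum.cong refl) auto
  moreover have "(\<Sum>j<n. mix_grad C n W j \<bullet> (W' j - W j)) = (\<Sum>j<n. if j = i then grad r i \<bullet> d else 0)"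
    unfolding diff by (intro sum.cong refl) (auto simp: W_def)
  moreover have "(\<Sum>j<n. if j = i then grad r i \<bullet> d else 0) = grad r i \<bullet> d"
    using i by simp
  ultimately have "mix_obj C n W' = mix_obj C n W + 2 * (grad r i \<bullet> d)"
    using mix_obj_expand[OF symm, of W' W] by simp
  moreover have "grad r i \<bullet> d = - (norm (grad r i) * ((step r i)\<^sup>2 / 2))"
  proof -
    have "grad r i \<bullet> d = - (norm (grad r i) * (X (Suc r) i \<bullet> d))"
      by (subst grad_eq[OF i]) simp
    then show ?thesis
      using unit_inner_diff[OF X_unit[OF i, of "Suc r"] X_unit[OF i, of r]] by (simp add: d_def)
  qed
  ultimately show ?thesis by (simp add: W_def W'_def)
qed

lemma mix_obj_descent:
  "mix_obj C n (X (Suc r)) = mix_obj C n (X r) - (\<Sum>i<n. norm (grad r i) * (step r i)\<^sup>2)"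
proof -
  have "mix_obj C n (mix_partial C n V0 r m) = mix_obj C n (X r) - (\<Sum>i<m. norm (grad r i) * (step r i)\<^sup>2)" if "m \<le> n" for m
    using that by (induction m) (simp_all add: mix_partial_0 mix_obj_partial_Suc)
  from this[of n] show ?thesis by (simp add: mix_partial_n)
qed

lemma mix_obj_antimono: "mix_obj C n (X (Suc r)) \<le> mix_obj C n (X r)"
  unfolding mix_obj_descent by (simp add: sum_nonneg)

lemma mix_obj_strict:
  assumes "\<exists>i<n. X (Suc r) i \<noteq> X r i"
  shows "mix_obj C n (X (Suc r)) < mix_obj C n (X r)"
proof -
  obtain i where i: "i < n" "X (Suc r) i \<noteq> X r i" using assms by blast
  then have "0 < norm (grad r i) * (step r i)\<^sup>2"
    using grad_nonzero[OF i(1), of r] by simp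
  then have "0 < (\<Sum>i<n. norm (grad r i) * (step r i)\<^sup>2)"
    using i(1) by (intro sum_pos2[of "{..<n}" i]) auto
  then show ?thesis unfolding mix_obj_descent by simp
qed

lemma move_nonneg: "0 \<le> move r"
  by (simp add: move_def sum_nonneg)

lemma step_le_move: "i < n \<Longrightarrow> step r i \<le> move r"
  unfolding move_def by (rule member_le_sum) auto

text \<open>The Cauchy-Schwarz inequality turns the sum of squared steps into the square of their
  sum; this costs the factor \<open>n\<close>.\<close>

lemma move_descent: "\<delta> * (move r)\<^sup>2 \<le> n * (mix_obj C n (X r) - mix_obj C n (X (Suc r)))"
proof -
  have "\<delta> * (move r)\<^sup>2 \<le> \<delta> * ((\<Sum>i<n. (step r i)\<^sup>2) * n)"
    using sum_squared_le_sum_of_squares[of "step r" "{..<n}"] delta_pos by (simp add: move_def)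
  also have "\<dots> = n * (\<Sum>i<n. \<delta> * (step r i)\<^sup>2)"
    by (simp add: sum_distrib_left mult.left_commute mult.commute)
  also have "\<dots> \<le> n * (\<Sum>i<n. norm (grad r i) * (step r i)\<^sup>2)"
    using nondeg by (intro mult_left_mono sum_mono mult_right_mono) auto
  finally show ?thesis unfolding mix_obj_descent by simp
qed

text \<open>The gradient used in the update is cancelled by its norm times the new column. Hence the
  gradient at the start of the sweep, corrected by the same multiple of the old column, consists of
  differences between old and new columns.\<close>

lemma riem_grad_le_move:
  assumes i: "i < n"
  shows "norm (riem_grad C n (X r) i) \<le> 2 * abs_cost C n * move r"
proof -
  let ?g = "grad r i"
  have dist: "norm (X r j - mix_partial C n V0 r i j) \<le> move r" if j: "j < n" for j
  proof (cases "j < i")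
    case True
    then show ?thesis
      using step_le_move[OF j, of r] mix_partial_less[of j i n C V0 r] i by (simp add: norm_minus_commute)
  next
    case False
    then show ?thesis using mix_partial_ge[of i j C n V0 r] move_nonneg by simp
  qed
  have unit: "norm (mix_partial C n V0 r i j) \<le> 1" if j: "j < n" for j
    using mix_partial_less[of j i n C V0 r] mix_partial_ge[of i j C n V0 r] X_unit[OF j] i
    by (cases "j < i") simp_all
  have "norm (riem_grad C n (X r) i) \<le> norm (mix_grad C n (X r) i + norm ?g *\<^sub>R X r i)"
    unfolding riem_grad_def by (rule norm_tangent_le[OF X_unit[OF i]])
  also have "mix_grad C n (X r) i + norm ?g *\<^sub>R X r i =
      mix_grad C n (\<lambda>j. X r j - mix_partial C n V0 r i j) i + norm ?g *\<^sub>R (X r i - X (Suc r) i)"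
  proof -
    have "mix_grad C n (\<lambda>j. X r j - mix_partial C n V0 r i j) i = mix_grad C n (X r) i - ?g"
      by (simp add: mix_grad_def scaleR_diff_right sum_subtractf)
    moreover have "norm ?g *\<^sub>R X (Suc r) i = - ?g"
      using arg_cong[OF grad_eq[OF i, of r], of uminus] by simp
    ultimately show ?thesis
      by (simp add: scaleR_diff_right)
  qed
  also have "norm \<dots> \<le> abs_cost C n * move r + norm ?g * step r i"
    using norm_mix_grad_le[OF i, of "\<lambda>j. X r j - mix_partial C n V0 r i j" "move r" C] dist move_nonneg
    by (intro norm_triangle_le) (simp add: norm_minus_commute)
  also have "norm ?g * step r i \<le> (abs_cost C n * 1) * move r"
    using norm_mix_grad_le[OF i, of "mix_partial C n V0 r i" 1 C] unit step_le_move[OF i] abs_cost_nonneg by (intro mult_mono) auto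
  finally show ?thesis by simp
qed

lemma mix_obj_X_bounded: "\<bar>mix_obj C n (X r)\<bar> \<le> abs_cost C n"
  using abs_mix_obj_le[of n "X r" 1 C] X_unit by simp

lemma summable_move: "summable move"
proof -
  define F where "F r = mix_obj C n (X r)" for r
  have dec: "decseq F"
    unfolding decseq_Suc_iff F_def using mix_obj_antimono by blast
  have lb: "- abs_cost C n \<le> F r" for r
    using mix_obj_X_bounded[of r] unfolding F_def by linarith
  obtain c where c: "F \<longlonglongrightarrow> c" "\<forall>r. c \<le> F r"
    by (rule decseq_convergent[OF dec]) (use lb in auto)
  show ?thesis
  proof (cases "\<exists>R. F R = c")
    \<comment> \<open>The inequality for \<psi> concerns values strictly above \<open>c\<close>. A
      run that attains its limit value has no drop left, hence no movement.\<close>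
    case True
    then obtain R where R: "F R = c" by blast
    have const: "F r = c" if "R \<le> r" for r
      using decseqD[OF dec that] c(2)[rule_format, of r] R by simp
    have "move r = 0" if "R \<le> r" for r
      using move_descent[of r] const[of r] const[of "Suc r"] that delta_pos
      by (simp add: F_def mult_le_0_iff)
    then show ?thesis
      by (intro summable_finite[of "{..<R}"]) (auto simp: not_less)
  next
    case False
    then have gt: "c < F r" for r using c(2) by (metis order_le_less)
    have freq: "\<exists>V :: nat \<Rightarrow> real^'k. (\<forall>i<n. norm (V i) = 1) \<and> c < mix_obj C n V \<and> mix_obj C n V < c + \<epsilon>" if "\<epsilon> > 0" for \<epsilon>
    proof -
      have "eventually (\<lambda>r. F r < c + \<epsilon>) sequentially"
        using order_tendstoD(2)[OF c(1), of "c + \<epsilon>"] that by simp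
      then obtain r where "F r < c + \<epsilon>" by (auto simp: eventually_sequentially)
      then show ?thesis using gt[of r] X_unit by (intro exI[of _ "X r"]) (auto simp: F_def)
    qed
    from mix_obj_desingularisation[OF symm freq] obtain \<rho> \<psi> B where \<rho>: "\<rho> > 0"
      and \<psi>: "\<And>t. t \<in> {0<..<\<rho>} \<Longrightarrow> \<bar>\<psi> t\<bar> \<le> B"
      and ineq: "\<And>(V :: nat \<Rightarrow> real^'k) s t. \<forall>i<n. norm (V i) = 1 \<Longrightarrow> 0 < s \<Longrightarrow> s \<le> t \<Longrightarrow> t < \<rho> \<Longrightarrow>
        mix_obj C n V = c + t \<Longrightarrow> t - s \<le> sqrt (\<Sum>i<n. (norm (riem_grad C n V i))\<^sup>2) * (\<psi> t - \<psi> s)"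
      by blast
    have "eventually (\<lambda>r. F r < c + \<rho>) sequentially"
      using order_tendstoD(2)[OF c(1), of "c + \<rho>"] \<rho> by simp
    then obtain R where R: "\<And>r. R \<le> r \<Longrightarrow> F r < c + \<rho>" by (auto simp: eventually_sequentially)
    define p where "p r = \<psi> (F r - c)" for r
    have p_bd: "\<bar>p r\<bar> \<le> B" if "R \<le> r" for r
      unfolding p_def using \<psi> gt[of r] R[OF that] by simp
    \<comment> \<open>Product of the descent constant \<open>n / \<delta>\<close> and the factor
      \<open>n * (2 * abs_cost C n)\<close> that bounds the slope by \<open>move r\<close>.\<close>
    define E where "E = n * (n * (2 * abs_cost C n)) / \<delta>"
    have E0: "0 \<le> E" using delta_pos abs_cost_nonneg by (simp add: E_def)
    have move_le: "move r \<le> E * (p r - p (Suc r))" if r: "R \<le> r" for r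
    proof (cases "move r = 0")
      case True
      then have "step r i = 0" if "i < n" for i
        using step_le_move[OF that, of r] by simp
      then have "F (Suc r) = F r" unfolding F_def mix_obj_descent by simp
      then show ?thesis using True by (simp add: p_def)
    next
      case False
      then have pos: "move r > 0" using move_nonneg[of r] by simp
      let ?s = "sqrt (\<Sum>i<n. (norm (riem_grad C n (X r) i))\<^sup>2)"
      have drop: "F r - F (Suc r) \<le> ?s * (p r - p (Suc r))"
      proof -
        have "(F r - c) - (F (Suc r) - c) \<le> ?s * (\<psi> (F r - c) - \<psi> (F (Suc r) - c))"
        proof (rule ineq)
          show "\<forall>i<n. norm (X r i) = 1" using X_unit by blast
          show "0 < F (Suc r) - c" using gt[of "Suc r"] by simp
          show "F (Suc r) - c \<le> F r - c" using decseqD[OF dec, of r "Suc r"] by simp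
          show "F r - c < \<rho>" using R[OF r] by simp
          show "mix_obj C n (X r) = c + (F r - c)" by (simp add: F_def)
        qed
        then show ?thesis by (simp add: p_def)
      qed
      have s_le: "?s \<le> n * (2 * abs_cost C n) * move r"
      proof -
        have "?s \<le> (\<Sum>i<n. norm (riem_grad C n (X r) i))"
          unfolding L2_set_def[symmetric] by (rule L2_set_le_sum) simp
        also have "\<dots> \<le> (\<Sum>i<n. 2 * abs_cost C n * move r)"
          by (rule sum_mono) (simp add: riem_grad_le_move)
        also have "\<dots> = n * (2 * abs_cost C n) * move r" by simp
        finally show ?thesis .
      qed
      define k where "k = n * (2 * abs_cost C n)"
      define d where "d = p r - p (Suc r)"
      have \<delta>_le: "\<delta> * (move r)\<^sup>2 \<le> n * (F r - F (Suc r))" unfolding F_def by (rule move_descent)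
      have pos2: "0 < \<delta> * (move r)\<^sup>2" using delta_pos pos by simp
      \<comment> \<open>Monotonicity of \<psi> is not among the available facts; a negative
        \<open>d\<close> would make the drop nonpositive, against \<open>move r > 0\<close>.\<close>
      have "0 \<le> d"
      proof (rule ccontr)
        assume "\<not> 0 \<le> d"
        then have "?s * d \<le> 0" by (intro mult_nonneg_nonpos) (auto intro: sum_nonneg)
        then have "F r - F (Suc r) \<le> 0" using drop unfolding d_def by (rule order_trans[rotated])
        then have "real n * (F r - F (Suc r)) \<le> 0" by (intro mult_nonneg_nonpos) auto
        with \<delta>_le pos2 show False by linarith
      qed
      then have "?s * d \<le> k * move r * d"
        using s_le unfolding k_def by (intro mult_right_mono)
      then have "F r - F (Suc r) \<le> k * move r * d"
        using drop unfolding d_def by (rule order_trans[rotated])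
      then have "n * (F r - F (Suc r)) \<le> n * (k * move r * d)"
        by (rule mult_left_mono) simp
      with \<delta>_le have "\<delta> * (move r)\<^sup>2 \<le> n * (k * move r * d)"
        by (rule order_trans)
      then have "move r * (\<delta> * move r) \<le> move r * (n * k * d)"
        by (simp only: power2_eq_square ac_simps)
      then have "\<delta> * move r \<le> n * k * d"
        using pos by (simp only: mult_le_cancel_left_pos)
      then have "move r \<le> n * k * d / \<delta>"
        using delta_pos by (simp only: pos_le_divide_eq mult.commute)
      then show ?thesis by (simp add: E_def k_def d_def)
    qed
    have "summable (\<lambda>r. move (r + R))"
    proof (rule summableI_nonneg_bounded)
      fix m
      have "(\<Sum>r<m. move (r + R)) \<le> (\<Sum>r<m. E * (p (r + R) - p (Suc r + R)))"
        by (intro sum_mono) (use move_le in simp)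
      also have "\<dots> = E * (p (0 + R) - p (m + R))"
        unfolding sum_distrib_left[symmetric] by (subst sum_lessThan_telescope') simp
      also have "\<dots> \<le> E * (2 * B)"
        using p_bd[of R] p_bd[of "m + R"] E0 by (intro mult_left_mono) auto
      finally show "(\<Sum>r<m. move (r + R)) \<le> E * (2 * B)" .
    qed (rule move_nonneg)
    then show ?thesis by (simp add: summable_iff_shift)
  qed
qed

lemma X_convergent: "i < n \<Longrightarrow> convergent (\<lambda>r. X r i)"
proof -
  assume i: "i < n"
  have "summable (\<lambda>r. X (Suc r) i - X r i)"
    by (rule summable_comparison_test'[OF summable_move, of 0]) (use step_le_move[OF i] in simp)
  then have "convergent (\<lambda>m. \<Sum>r<m. X (Suc r) i - X r i)"
    by (simp add: summable_iff_convergent)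
  then have "convergent (\<lambda>m. (\<Sum>r<m. X (Suc r) i - X r i) + X 0 i)"
    by (intro convergent_add convergent_const)
  moreover have "(\<Sum>r<m. X (Suc r) i - X r i) + X 0 i = X m i" for m
    using sum_lessThan_telescope[of "\<lambda>r. X r i" m] by simp
  ultimately show ?thesis by (simp only:)
qed

text \<open>The Riemannian gradient depends continuously on the columns and is bounded along the run
  by a multiple of \<open>move r\<close>, which tends to 0.\<close>

lemma limit_critical:
  assumes lim: "\<And>i. i < n \<Longrightarrow> (\<lambda>r. X r i) \<longlonglongrightarrow> V i"
  shows "mix_critical C n V"
  unfolding mix_critical_def
proof (intro allI impI conjI)
  fix i assume i: "i < n"
  have "(\<lambda>r. norm (X r i)) \<longlonglongrightarrow> norm (V i)" by (intro tendsto_norm lim i)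
  then show "norm (V i) = 1"
    using X_unit[OF i] by (simp add: LIMSEQ_const_iff)
  have "(\<lambda>r. mix_grad C n (X r) i) \<longlonglongrightarrow> mix_grad C n V i"
    unfolding mix_grad_def by (intro tendsto_sum tendsto_scaleR tendsto_const lim) simp
  then have "(\<lambda>r. riem_grad C n (X r) i) \<longlonglongrightarrow> riem_grad C n V i"
    unfolding riem_grad_def by (intro tendsto_diff tendsto_scaleR tendsto_inner lim i)
  moreover have "(\<lambda>r. riem_grad C n (X r) i) \<longlonglongrightarrow> 0"
  proof (rule Lim_null_comparison)
    show "eventually (\<lambda>r. norm (riem_grad C n (X r) i) \<le> 2 * abs_cost C n * move r) sequentially"
      using riem_grad_le_move[OF i] by simp
    show "(\<lambda>r. 2 * abs_cost C n * move r) \<longlonglongrightarrow> 0"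
      by (rule tendsto_mult_right_zero[OF summable_LIMSEQ_zero[OF summable_move]])
  qed
  ultimately have "riem_grad C n V i = 0"
    by (rule LIMSEQ_unique)
  then show "mix_grad C n V i - (V i \<bullet> mix_grad C n V i) *\<^sub>R V i = 0"
    by (simp add: riem_grad_def)
qed

end

text \<open>Strict decrease is claimed for sweeps that move some column, since at a fixed point of
  the sweep the objective cannot change.\<close>

theorem theorem1:
  fixes C :: "nat \<Rightarrow> nat \<Rightarrow> real" and n :: nat and V0 :: "nat \<Rightarrow> real^'k" and \<delta> :: real
  assumes symm: "\<forall>i<n. \<forall>j<n. C i j = C j i"
    and diag: "\<forall>i<n. C i i = 0"
    and init: "\<forall>i<n. norm (V0 i) = 1"
    and delta_pos: "\<delta> > 0"
    and nondeg: "\<forall>r i. i < n \<longrightarrow> norm (mix_grad C n (mix_partial C n V0 r i) i) \<ge> \<delta>"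
  shows "(\<forall>r. mix_obj C n (mix_iter C n V0 (Suc r)) \<le> mix_obj C n (mix_iter C n V0 r)
              \<and> ((\<exists>i<n. mix_iter C n V0 (Suc r) i \<noteq> mix_iter C n V0 r i)
                   \<longrightarrow> mix_obj C n (mix_iter C n V0 (Suc r)) < mix_obj C n (mix_iter C n V0 r)))
       \<and> (\<exists>Vs. (\<forall>i<n. (\<lambda>r. mix_iter C n V0 r i) \<longlonglongrightarrow> Vs i) \<and> mix_critical C n Vs)"
proof -
  interpret mixing_run C n V0 \<delta>
    using assms by unfold_locales
  have lim: "(\<lambda>r. mix_iter C n V0 r i) \<longlonglongrightarrow> lim (\<lambda>r. mix_iter C n V0 r i)" if "i < n" for i
    using X_convergent[OF that] by (simp add: convergent_LIMSEQ_iff)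
  show ?thesis
  proof (intro conjI allI impI exI[of _ "\<lambda>i. lim (\<lambda>r. mix_iter C n V0 r i)"])
    show "mix_critical C n (\<lambda>i. lim (\<lambda>r. mix_iter C n V0 r i))"
      by (rule limit_critical) (rule lim)
  qed (use mix_obj_antimono mix_obj_strict lim in blast)+
qed

end
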